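(* The sphere $S^3$ is the only flag manifold of ${\rm SO}(1,4)$; that is, the unique flag manifold $\mathbb{F}=G/P$ of $G={\rm SO}(1,4)$ is diffeomorphic to $S^3$.
   Context: The group ${\rm SO}(1,4)$ is taken to be connected (i.e. the identity component of the group of real $5\times 5$ matrices of determinant one preserving the quadratic form ${\rm diag}(1,-1,-1,-1,-1)$), with maximal compact subgroup $K\cong{\rm SO}(4)$ consisting of the block matrices ${\rm diag}(1,k)$, $k\in{\rm SO}(4)$. A flag manifold of a noncompact semisimple Lie group $G$ is a homogeneous space $G/P_\Theta$ with $P_\Theta$ a proper parabolic subgroup (up to conjugation, the one attached to a proper subset $\Theta$ of the simple restricted roots). The Lie algebra $\mathfrak{so}(1,4)$ has real rank one, with a single simple restricted root. *)

theory Defs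
  imports "HOL-Analysis.Analysis"
begin

section \<open>The group and its Lie algebra\<close>

text \<open>The index type \<open>5\<close> has elements \<open>0, 1, 2, 3, 4\<close> (with \<open>5 = 0\<close>); the timelike coordinate is \<open>1\<close>.\<close>

definition lorentz_form :: "real^5^5" where
  "lorentz_form = (\<chi> i j. if i = j then (if i = 1 then 1 else -1) else 0)"

definition full_SO14 :: "(real^5^5) set" where
  "full_SO14 = {A. det A = 1 \<and> transpose A ** lorentz_form ** A = lorentz_form}"

definition SO14 :: "(real^5^5) set" where
  "SO14 = connected_component_set full_SO14 (mat 1)"

definition so14 :: "(real^5^5) set" where
  "so14 = {X. transpose X ** lorentz_form + lorentz_form ** X = 0}"

section \<open>Parabolic subgroups of matrix groups\<close>

text \<open>
  In this section \<open>L\<close> is the Lie algebra of a matrix group \<open>G\<close>, stable under the Cartan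
  involution \<open>X \<mapsto> - transpose X\<close>.  The noncompact part of the Cartan decomposition consists of
  the symmetric matrices in \<open>L\<close>; for \<open>so14\<close> the compact part is the Lie algebra of
  the group of block matrices \<open>diag(1, k)\<close> with \<open>k\<close> in \<open>SO(4)\<close>.
\<close>

definition lie_bracket :: "real^'n^'n \<Rightarrow> real^'n^'n \<Rightarrow> real^'n^'n" where
  "lie_bracket X Y = X ** Y - Y ** X"

definition cartan_noncompact :: "(real^'n^'n) set \<Rightarrow> (real^'n^'n) set" where
  "cartan_noncompact L = {X \<in> L. transpose X = X}"

definition abelian_in_noncompact :: "(real^'n^'n) set \<Rightarrow> (real^'n^'n) set \<Rightarrow> bool" where
  "abelian_in_noncompact L a \<longleftrightarrow>
     subspace a \<and> a \<subseteq> cartan_noncompact L \<and> (\<forall>X\<in>a. \<forall>Y\<in>a. lie_bracket X Y = 0)"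

definition maximal_abelian :: "(real^'n^'n) set \<Rightarrow> (real^'n^'n) set \<Rightarrow> bool" where
  "maximal_abelian L a \<longleftrightarrow>
     abelian_in_noncompact L a \<and> (\<forall>b. abelian_in_noncompact L b \<and> a \<subseteq> b \<longrightarrow> b = a)"

definition root_space ::
  "(real^'n^'n) set \<Rightarrow> (real^'n^'n) set \<Rightarrow> (real^'n^'n \<Rightarrow> real) \<Rightarrow> (real^'n^'n) set" where
  "root_space L a \<alpha> = {X \<in> L. \<forall>H\<in>a. lie_bracket H X = \<alpha> H *\<^sub>R X}"

text \<open>Linear functionals on \<open>a\<close> are represented by functions that are \<open>undefined\<close> outside \<open>a\<close>,
  so that equality of functionals is equality of functions.\<close>

definition restricted_roots ::
  "(real^'n^'n) set \<Rightarrow> (real^'n^'n) set \<Rightarrow> (real^'n^'n \<Rightarrow> real) set" where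
  "restricted_roots L a =
     {\<alpha>. (\<exists>f. linear f \<and> \<alpha> = restrict f a) \<and> (\<exists>H\<in>a. \<alpha> H \<noteq> 0) \<and> root_space L a \<alpha> \<noteq> {0}}"

text \<open>A regular element \<open>H0\<close> of \<open>a\<close> selects the Weyl chamber containing it.\<close>

definition regular_element ::
  "(real^'n^'n) set \<Rightarrow> (real^'n^'n) set \<Rightarrow> real^'n^'n \<Rightarrow> bool" where
  "regular_element L a H0 \<longleftrightarrow> H0 \<in> a \<and> (\<forall>\<alpha>\<in>restricted_roots L a. \<alpha> H0 \<noteq> 0)"

definition positive_roots ::
  "(real^'n^'n) set \<Rightarrow> (real^'n^'n) set \<Rightarrow> real^'n^'n \<Rightarrow> (real^'n^'n \<Rightarrow> real) set" where
  "positive_roots L a H0 = {\<alpha> \<in> restricted_roots L a. 0 < \<alpha> H0}"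

definition simple_roots ::
  "(real^'n^'n) set \<Rightarrow> (real^'n^'n) set \<Rightarrow> real^'n^'n \<Rightarrow> (real^'n^'n \<Rightarrow> real) set" where
  "simple_roots L a H0 =
     {\<alpha> \<in> positive_roots L a H0.
        \<not> (\<exists>\<beta>\<in>positive_roots L a H0. \<exists>\<gamma>\<in>positive_roots L a H0. \<forall>H\<in>a. \<alpha> H = \<beta> H + \<gamma> H)}"

definition generated_positive_roots ::
  "(real^'n^'n) set \<Rightarrow> (real^'n^'n) set \<Rightarrow> real^'n^'n \<Rightarrow> (real^'n^'n \<Rightarrow> real) set
     \<Rightarrow> (real^'n^'n \<Rightarrow> real) set" where
  "generated_positive_roots L a H0 \<Theta> =
     {\<alpha> \<in> positive_roots L a H0.
        \<exists>c :: (real^'n^'n \<Rightarrow> real) \<Rightarrow> nat. \<forall>H\<in>a. \<alpha> H = (\<Sum>\<beta>\<in>\<Theta>. real (c \<beta>) * \<beta> H)}"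

text \<open>
  The parabolic subalgebra attached to \<open>\<Theta>\<close>: the minimal parabolic subalgebra (the centralizer
  of \<open>a\<close> plus the positive root spaces), plus the root spaces of the negatives of the positive
  roots generated by \<open>\<Theta>\<close>.
\<close>

definition parabolic_subalgebra ::
  "(real^'n^'n) set \<Rightarrow> (real^'n^'n) set \<Rightarrow> real^'n^'n \<Rightarrow> (real^'n^'n \<Rightarrow> real) set
     \<Rightarrow> (real^'n^'n) set" where
  "parabolic_subalgebra L a H0 \<Theta> =
     span (root_space L a (\<lambda>_. 0)
           \<union> (\<Union>\<alpha>\<in>positive_roots L a H0. root_space L a \<alpha>)
           \<union> (\<Union>\<alpha>\<in>generated_positive_roots L a H0 \<Theta>. root_space L a (\<lambda>H. - \<alpha> H)))"

definition conjugate :: "real^'n^'n \<Rightarrow> (real^'n^'n) set \<Rightarrow> (real^'n^'n) set" where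
  "conjugate g S = (\<lambda>X. g ** X ** matrix_inv g) ` S"

definition parabolic_subgroup ::
  "(real^'n^'n) set \<Rightarrow> (real^'n^'n) set \<Rightarrow> (real^'n^'n) set \<Rightarrow> real^'n^'n
     \<Rightarrow> (real^'n^'n \<Rightarrow> real) set \<Rightarrow> (real^'n^'n) set" where
  "parabolic_subgroup G L a H0 \<Theta> =
     {g \<in> G. conjugate g (parabolic_subalgebra L a H0 \<Theta>) = parabolic_subalgebra L a H0 \<Theta>}"

definition is_proper_parabolic ::
  "(real^'n^'n) set \<Rightarrow> (real^'n^'n) set \<Rightarrow> (real^'n^'n) set \<Rightarrow> bool" where
  "is_proper_parabolic G L P \<longleftrightarrow>
     (\<exists>a H0 \<Theta> g. maximal_abelian L a \<and> regular_element L a H0 \<and> \<Theta> \<subset> simple_roots L a H0 \<and>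
        g \<in> G \<and> P = conjugate g (parabolic_subgroup G L a H0 \<Theta>))"

section \<open>Smooth maps and smooth manifolds\<close>

text \<open>\<open>Ck_on k S f\<close> is meant for open sets \<open>S\<close>.\<close>

primrec Ck_on ::
  "nat \<Rightarrow> 'a::real_normed_vector set \<Rightarrow> ('a \<Rightarrow> 'b::real_normed_vector) \<Rightarrow> bool" where
  "Ck_on 0 S f \<longleftrightarrow> continuous_on S f"
| "Ck_on (Suc k) S f \<longleftrightarrow>
     (\<forall>x\<in>S. f differentiable (at x)) \<and> (\<forall>v. Ck_on k S (\<lambda>x. frechet_derivative f (at x) v))"

definition smooth_on :: "'a::real_normed_vector set \<Rightarrow> ('a \<Rightarrow> 'b::real_normed_vector) \<Rightarrow> bool" where
  "smooth_on S f \<longleftrightarrow> (\<forall>k. Ck_on k S f)"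

text \<open>Maps defined on arbitrary subsets \<open>M\<close> of a Euclidean space, in particular on embedded
  submanifolds, are smooth if they locally extend to smooth maps of the ambient space.\<close>

definition smooth_extension_at ::
  "'a::euclidean_space set \<Rightarrow> 'a \<Rightarrow> ('a \<Rightarrow> 'b::euclidean_space) \<Rightarrow> ('a \<Rightarrow> 'b) \<Rightarrow> bool" where
  "smooth_extension_at M x f F \<longleftrightarrow>
     (\<exists>U. open U \<and> x \<in> U \<and> smooth_on U F \<and> (\<forall>y\<in>M \<inter> U. F y = f y))"

definition smooth_map_on ::
  "'a::euclidean_space set \<Rightarrow> ('a \<Rightarrow> 'b::euclidean_space) \<Rightarrow> bool" where
  "smooth_map_on M f \<longleftrightarrow> (\<forall>x\<in>M. \<exists>F. smooth_extension_at M x f F)"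

text \<open>For an embedded submanifold this is its tangent space.  The curve is only constrained
  near \<open>0\<close>, by differentiability there.\<close>

definition tangent_vectors :: "'a::euclidean_space set \<Rightarrow> 'a \<Rightarrow> 'a set" where
  "tangent_vectors M x =
     {v. \<exists>\<gamma> :: real \<Rightarrow> 'a. (\<forall>t. \<gamma> t \<in> M) \<and> \<gamma> 0 = x \<and> (\<gamma> has_vector_derivative v) (at 0)}"

text \<open>The differential of \<open>f\<close> at \<open>x\<close> is the restriction to the tangent space of the derivative
  of any local extension.\<close>

definition smooth_submersion_on ::
  "'a::euclidean_space set \<Rightarrow> ('a \<Rightarrow> 'b::euclidean_space) \<Rightarrow> bool" where
  "smooth_submersion_on M f \<longleftrightarrow>
     (\<forall>x\<in>M. \<exists>F. smooth_extension_at M x f F \<and>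
        frechet_derivative F (at x) ` tangent_vectors M x = UNIV)"

text \<open>A chart is a pair of its domain and the coordinate map; an atlas is not required to be
  maximal.\<close>

definition smooth_atlas ::
  "'p topology \<Rightarrow> ('p set \<times> ('p \<Rightarrow> 'm::euclidean_space)) set \<Rightarrow> bool" where
  "smooth_atlas X A \<longleftrightarrow>
     (\<forall>(U, \<phi>)\<in>A. openin X U \<and> open (\<phi> ` U) \<and>
        homeomorphic_map (subtopology X U) (top_of_set (\<phi> ` U)) \<phi>) \<and>
     (\<Union>(U, \<phi>)\<in>A. U) = topspace X \<and>
     (\<forall>(U, \<phi>)\<in>A. \<forall>(V, \<psi>)\<in>A. smooth_on (\<phi> ` (U \<inter> V)) (\<psi> \<circ> inv_into U \<phi>))"

definition smooth_manifold ::
  "'p topology \<Rightarrow> ('p set \<times> ('p \<Rightarrow> 'm::euclidean_space)) set \<Rightarrow> bool" where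
  "smooth_manifold X A \<longleftrightarrow> Hausdorff_space X \<and> second_countable X \<and> smooth_atlas X A"

text \<open>Diffeomorphism of a smooth manifold onto an embedded submanifold \<open>M\<close> of a Euclidean space.\<close>

definition diffeomorphic_to_submanifold ::
  "'p topology \<Rightarrow> ('p set \<times> ('p \<Rightarrow> 'm::euclidean_space)) set \<Rightarrow> 'e::euclidean_space set \<Rightarrow> bool" where
  "diffeomorphic_to_submanifold X A M \<longleftrightarrow>
     smooth_manifold X A \<and>
     (\<exists>f. homeomorphic_map X (top_of_set M) f \<and>
        (\<forall>(U, \<phi>)\<in>A. smooth_on (\<phi> ` U) (f \<circ> inv_into U \<phi>) \<and>
                     smooth_map_on (f ` U) (\<phi> \<circ> inv_into U f)))"

section \<open>Homogeneous spaces\<close>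

definition left_coset :: "(real^'n^'n) set \<Rightarrow> real^'n^'n \<Rightarrow> (real^'n^'n) set" where
  "left_coset P g = (\<lambda>p. g ** p) ` P"

definition coset_space :: "(real^'n^'n) set \<Rightarrow> (real^'n^'n) set \<Rightarrow> (real^'n^'n) set set" where
  "coset_space G P = left_coset P ` G"

definition coset_topology ::
  "(real^'n^'n) set \<Rightarrow> (real^'n^'n) set \<Rightarrow> (real^'n^'n) set topology" where
  "coset_topology G P =
     topology (\<lambda>W. W \<subseteq> coset_space G P \<and> openin (top_of_set G) {g \<in> G. left_coset P g \<in> W})"

lemma openin_coset_topology:
  "openin (coset_topology G P) W \<longleftrightarrow>
     W \<subseteq> coset_space G P \<and> openin (top_of_set G) {g \<in> G. left_coset P g \<in> W}"
proof -
  have "istopology (\<lambda>W. W \<subseteq> coset_space G P \<and> openin (top_of_set G) {g \<in> G. left_coset P g \<in> W})"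
    unfolding istopology_def
  proof (intro conjI allI impI)
    fix S T
    assume S: "S \<subseteq> coset_space G P \<and> openin (top_of_set G) {g \<in> G. left_coset P g \<in> S}"
      and T: "T \<subseteq> coset_space G P \<and> openin (top_of_set G) {g \<in> G. left_coset P g \<in> T}"
    show "S \<inter> T \<subseteq> coset_space G P" using S by blast
    have "{g \<in> G. left_coset P g \<in> S \<inter> T}
        = {g \<in> G. left_coset P g \<in> S} \<inter> {g \<in> G. left_coset P g \<in> T}" by blast
    then show "openin (top_of_set G) {g \<in> G. left_coset P g \<in> S \<inter> T}"
      using S T by (simp add: openin_Int)
  next
    fix \<K>
    assume K: "\<forall>S\<in>\<K>. S \<subseteq> coset_space G P \<and> openin (top_of_set G) {g \<in> G. left_coset P g \<in> S}"
    then show "\<Union>\<K> \<subseteq> coset_space G P" by blast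
    have "{g \<in> G. left_coset P g \<in> \<Union>\<K>} = (\<Union>S\<in>\<K>. {g \<in> G. left_coset P g \<in> S})" by blast
    moreover have "openin (top_of_set G) (\<Union>S\<in>\<K>. {g \<in> G. left_coset P g \<in> S})"
      using K by (intro openin_Union) auto
    ultimately show "openin (top_of_set G) {g \<in> G. left_coset P g \<in> \<Union>\<K>}" by simp
  qed
  then show ?thesis
    by (simp add: coset_topology_def topology_inverse')
qed

text \<open>\<open>A\<close> is an atlas of the quotient manifold \<open>G / P\<close>: the topology is the quotient topology and
  the projection from \<open>G\<close> is a smooth submersion.  This determines the smooth structure.\<close>

definition quotient_manifold_atlas ::
  "(real^'n^'n) set \<Rightarrow> (real^'n^'n) set
     \<Rightarrow> ((real^'n^'n) set set \<times> ((real^'n^'n) set \<Rightarrow> 'm::euclidean_space)) set \<Rightarrow> bool" where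
  "quotient_manifold_atlas G P A \<longleftrightarrow>
     smooth_manifold (coset_topology G P) A \<and>
     (\<forall>(U, \<phi>)\<in>A. smooth_submersion_on {g \<in> G. left_coset P g \<in> U} (\<lambda>g. \<phi> (left_coset P g)))"

end

theory Submission
  imports Defs
begin

text \<open>
  The Lorentz group permutes the light rays, that is, the lines spanned by the null vectors
  \<open>light x = (1, x)\<close> with \<open>x\<close> on the three-sphere.  The theorem holds because the proper parabolic
  subgroups are exactly the stabilizers of light rays (\<open>proper_parabolic_iff\<close>), so that \<open>G / P\<close> is the
  orbit of a ray, and this orbit consists of all rays.

  Parabolic subgroups.  The noncompact part of the Lie algebra consists of the boosts, one for each
  vector \<open>v\<close> of \<open>R^4\<close>, and two boosts commute only if their vectors are parallel; hence a maximal
  abelian subspace is a line spanned by \<open>boost v\<close> with \<open>v\<close> a unit vector.  The eigenvalues of \<open>boost v\<close>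
  on \<open>R^5\<close> are \<open>1\<close> on \<open>light v\<close>, \<open>-1\<close> on \<open>light (- v)\<close>, and \<open>0\<close> on the spatial vectors orthogonal to \<open>v\<close>.
  An element of the root space for the value \<open>c\<close> shifts eigenvalues by \<open>c\<close>, and its skewness for the
  Lorentz form excludes every positive \<open>c\<close> other than \<open>1\<close> (\<open>boost_eigenvalue\<close>).  So there is a single
  positive root, the only proper subset of the simple roots is empty, and the parabolic subalgebra is
  the sum of the eigenspaces of \<open>ad (boost v)\<close> for \<open>0\<close> and \<open>1\<close>.  This sum is the algebra of all
  elements that have \<open>light v\<close> as an eigenvector (\<open>span_boost_eigenspaces\<close>).  That algebra
  determines the ray (\<open>ray_stabilizer_algebra_inj\<close>), so its normalizer is the stabilizer of the ray.

  The quotient.  Left multiplication by a unit quaternion \<open>x\<close> is a rotation that depends affinely on \<open>x\<close>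
  and carries the ray of the quaternion \<open>1\<close> to the ray of \<open>x\<close>.  This makes the map from the group to the
  sphere a trivial bundle: it has a smooth global section through every group element.  The locale
  \<open>fibration_over_sphere\<close> derives the rest from such sections.  The quotient topology is that of the
  sphere, and the stereographic charts form a quotient atlas, because sections produce curves in
  the group over any prescribed curve in the sphere.  If conversely a quotient atlas is given, a chart is
  smooth as a function on the sphere since it can be composed with a section.  In stereographic
  coordinates it then becomes an injective smooth map between open sets of \<open>R^3\<close>; the submersion
  condition makes its derivative surjective, and such a map has a smooth inverse
  (\<open>smooth_on_inverse_of_injective\<close>).
\<close>

section \<open>Smooth maps between open sets\<close>

text \<open>
  Derivatives are taken in the ambient space; functions that agree only on \<open>S\<close> have the same derivatives
  there because \<open>S\<close> is open.  This is what allows derivatives to be replaced by explicit formulas.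
\<close>

lemma Ck_on_cong:
  assumes "Ck_on k S f" "open S" "\<And>x. x \<in> S \<Longrightarrow> f x = g x"
  shows "Ck_on k S g"
  using assms
proof (induction k arbitrary: f g)
  case 0
  then show ?case
    by (simp cong: continuous_on_cong)
next
  case (Suc k)
  have D: "(g has_derivative frechet_derivative f (at x)) (at x)" if "x \<in> S" for x
  proof (rule has_derivative_transform_within_open)
    show "(f has_derivative frechet_derivative f (at x)) (at x)"
      using Suc.prems that by (auto simp: frechet_derivative_works)
  qed (use Suc.prems that in auto)
  have "Ck_on k S (\<lambda>x. frechet_derivative g (at x) v)" for v
  proof (rule Suc.IH)
    show "Ck_on k S (\<lambda>x. frechet_derivative f (at x) v)"
      using Suc.prems by auto
    show "frechet_derivative f (at x) v = frechet_derivative g (at x) v" if "x \<in> S" for x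
      using frechet_derivative_at[OF D[OF that]] by simp
  qed (rule Suc.prems)
  then show ?case
    using D by (auto simp: differentiable_def)
qed

lemma Ck_on_derivativeI:
  assumes D: "\<And>x. x \<in> S \<Longrightarrow> (f has_derivative f' x) (at x)" and "open S"
    and Ck: "\<And>v. Ck_on k S (\<lambda>x. f' x v)"
  shows "Ck_on (Suc k) S f"
proof -
  have "Ck_on k S (\<lambda>x. frechet_derivative f (at x) v)" for v
    by (rule Ck_on_cong[OF Ck[of v] \<open>open S\<close>]) (simp add: frechet_derivative_at[OF D])
  then show ?thesis
    using D by (auto simp: differentiable_def)
qed

lemma Ck_on_has_derivative:
  "Ck_on (Suc k) S f \<Longrightarrow> x \<in> S \<Longrightarrow> (f has_derivative frechet_derivative f (at x)) (at x)"
  by (auto simp: frechet_derivative_works)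

lemma Ck_on_Suc_imp: "Ck_on (Suc k) S f \<Longrightarrow> Ck_on k S f"
proof (induction k arbitrary: f)
  case 0
  then show ?case
    by (auto intro!: continuous_at_imp_continuous_on differentiable_imp_continuous_within)
next
  case (Suc k)
  then show ?case by auto
qed

lemma Ck_on_subset: "Ck_on k S f \<Longrightarrow> T \<subseteq> S \<Longrightarrow> Ck_on k T f"
  by (induction k arbitrary: f) (auto intro: continuous_on_subset)

lemma Ck_on_local:
  assumes "\<And>x. x \<in> S \<Longrightarrow> \<exists>W. open W \<and> x \<in> W \<and> Ck_on k W f"
  shows "Ck_on k S f"
  using assms
proof (induction k arbitrary: f)
  case 0
  then show ?case
    by (metis Ck_on.simps(1) continuous_at_imp_continuous_on continuous_on_eq_continuous_at)
next
  case (Suc k)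
  have "f differentiable at x" if "x \<in> S" for x
    using Suc.prems[OF that] by auto
  moreover have "Ck_on k S (\<lambda>x. frechet_derivative f (at x) v)" for v
  proof (rule Suc.IH)
    fix x assume "x \<in> S"
    then show "\<exists>W. open W \<and> x \<in> W \<and> Ck_on k W (\<lambda>x. frechet_derivative f (at x) v)"
      using Suc.prems by fastforce
  qed
  ultimately show ?case by simp
qed

lemma Ck_on_const: "open S \<Longrightarrow> Ck_on k S (\<lambda>x. c)"
proof (induction k arbitrary: c)
  case (Suc k)
  then show ?case
    by (intro Ck_on_derivativeI[where f' = "\<lambda>x v. 0"]) (auto intro!: derivative_eq_intros)
qed auto

lemma Ck_on_bounded_linear:
  assumes "bounded_linear f" "open S"
  shows "Ck_on k S f"
proof (cases k)
  case 0
  then show ?thesis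
    using assms by (simp add: linear_continuous_on)
next
  case (Suc j)
  then show ?thesis
    using assms Ck_on_derivativeI[of S f "\<lambda>x. f"]
    by (simp only: Suc) (auto intro!: Ck_on_derivativeI[where f' = "\<lambda>x. f"] Ck_on_const
        bounded_linear_imp_has_derivative)
qed

lemma Ck_on_add:
  assumes "Ck_on k S f" "Ck_on k S g" "open S"
  shows "Ck_on k S (\<lambda>x. f x + g x)"
  using assms
proof (induction k arbitrary: f g)
  case (Suc k)
  show ?case
  proof (rule Ck_on_derivativeI)
    fix x assume "x \<in> S"
    then show "((\<lambda>x. f x + g x) has_derivative
        (\<lambda>v. frechet_derivative f (at x) v + frechet_derivative g (at x) v)) (at x)"
      using Suc.prems by (intro has_derivative_add Ck_on_has_derivative)
  next
    fix v
    show "Ck_on k S (\<lambda>x. frechet_derivative f (at x) v + frechet_derivative g (at x) v)"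
      using Suc.prems by (intro Suc.IH) auto
  qed (use Suc in auto)
qed (auto intro: continuous_on_add)

lemma Ck_on_sum:
  assumes "finite I" "\<And>i. i \<in> I \<Longrightarrow> Ck_on k S (f i)" "open S"
  shows "Ck_on k S (\<lambda>x. \<Sum>i\<in>I. f i x)"
  using assms by (induction I) (auto intro: Ck_on_const Ck_on_add)

lemma Ck_on_bilinear:
  assumes "bounded_bilinear B" "Ck_on k S f" "Ck_on k S g" "open S"
  shows "Ck_on k S (\<lambda>x. B (f x) (g x))"
  using assms(2-)
proof (induction k arbitrary: f g)
  case 0
  then show ?case
    using bounded_bilinear.continuous_on[OF assms(1)] by auto
next
  case (Suc k)
  show ?case
  proof (rule Ck_on_derivativeI)
    fix x assume "x \<in> S"
    then show "((\<lambda>x. B (f x) (g x)) has_derivative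
        (\<lambda>v. B (f x) (frechet_derivative g (at x) v) + B (frechet_derivative f (at x) v) (g x))) (at x)"
      using Suc.prems by (intro bounded_bilinear.FDERIV[OF assms(1)] Ck_on_has_derivative)
  next
    fix v
    show "Ck_on k S
       (\<lambda>x. B (f x) (frechet_derivative g (at x) v) + B (frechet_derivative f (at x) v) (g x))"
      using Suc.prems Ck_on_Suc_imp[OF Suc.prems(1)] Ck_on_Suc_imp[OF Suc.prems(2)]
      by (intro Ck_on_add Suc.IH) auto
  qed (use Suc in auto)
qed

text \<open>
  Only directional derivatives are available in the definition of \<open>Ck_on\<close>.  The chain rule is therefore
  expanded in a basis of the intermediate space, which turns the derivative of \<open>f\<close> in the varying
  direction \<open>Dg x v\<close> into a combination of derivatives in fixed directions.
\<close>

lemma Ck_on_compose: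
  fixes f :: "'b::euclidean_space \<Rightarrow> 'c::real_normed_vector"
    and g :: "'a::real_normed_vector \<Rightarrow> 'b"
  assumes "Ck_on k S g" "Ck_on k W f" "g ` S \<subseteq> W" "open S" "open W"
  shows "Ck_on k S (\<lambda>x. f (g x))"
  using assms
proof (induction k arbitrary: f g)
  case 0
  then show ?case
    using continuous_on_compose2[of W f S g] by auto
next
  case (Suc k)
  let ?Df = "\<lambda>x. frechet_derivative f (at x)" and ?Dg = "\<lambda>x. frechet_derivative g (at x)"
  have D: "((\<lambda>x. f (g x)) has_derivative (\<lambda>v. ?Df (g x) (?Dg x v))) (at x)" if "x \<in> S" for x
    using diff_chain_at[of g "?Dg x" x f "?Df (g x)"] Suc.prems that
    by (auto simp: o_def frechet_derivative_works)
  have expand: "?Df (g x) (?Dg x v) = (\<Sum>b\<in>Basis. (?Dg x v \<bullet> b) *\<^sub>R ?Df (g x) b)" if "x \<in> S" for x v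
  proof -
    have lin: "linear (?Df (g x))"
      using Suc.prems that by (intro has_derivative_linear[OF Ck_on_has_derivative[of k W]]) auto
    have "?Df (g x) (\<Sum>b\<in>Basis. (?Dg x v \<bullet> b) *\<^sub>R b) = (\<Sum>b\<in>Basis. (?Dg x v \<bullet> b) *\<^sub>R ?Df (g x) b)"
      by (simp add: linear_sum[OF lin] linear_cmul[OF lin])
    then show ?thesis
      by (simp add: euclidean_representation)
  qed
  show ?case
  proof (rule Ck_on_derivativeI[OF D \<open>open S\<close>])
    fix v
    have "Ck_on k S (\<lambda>x. \<Sum>b\<in>Basis. (?Dg x v \<bullet> b) *\<^sub>R ?Df (g x) b)"
    proof (intro Ck_on_sum Ck_on_bilinear[OF bounded_bilinear_scaleR]
        Ck_on_bilinear[OF bounded_bilinear_inner] Ck_on_const)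
      show "Ck_on k S (\<lambda>x. ?Dg x v)" using Suc.prems by auto
      show "Ck_on k S (\<lambda>x. ?Df (g x) b)" for b
        using Suc.prems Ck_on_Suc_imp[OF Suc.prems(1)] by (intro Suc.IH[of g "\<lambda>y. ?Df y b"]) auto
    qed (use Suc.prems in auto)
    then show "Ck_on k S (\<lambda>x. ?Df (g x) (?Dg x v))"
      by (rule Ck_on_cong) (use Suc.prems expand in auto)
  qed auto
qed

lemma Ck_on_inverse:
  fixes f :: "'a::real_normed_vector \<Rightarrow> real"
  assumes "Ck_on k S f" "open S" "\<And>x. x \<in> S \<Longrightarrow> f x \<noteq> 0"
  shows "Ck_on k S (\<lambda>x. inverse (f x))"
  using assms
proof (induction k)
  case (Suc k)
  show ?case
  proof (rule Ck_on_derivativeI)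
    fix x assume "x \<in> S"
    then show "((\<lambda>x. inverse (f x)) has_derivative
        (\<lambda>v. - (inverse (f x) * frechet_derivative f (at x) v * inverse (f x)))) (at x)"
      using Suc.prems by (intro Deriv.has_derivative_inverse Ck_on_has_derivative) auto
  next
    fix v
    have I: "Ck_on k S (\<lambda>x. inverse (f x))"
      using Suc.prems Ck_on_Suc_imp[OF Suc.prems(1)] by (intro Suc.IH)
    have D: "Ck_on k S (\<lambda>x. frechet_derivative f (at x) v)"
      using Suc.prems by auto
    have "Ck_on k S (\<lambda>x. (- 1) * ((inverse (f x) * frechet_derivative f (at x) v) * inverse (f x)))"
      using I D Suc.prems by (intro Ck_on_bilinear[OF bounded_bilinear_mult] Ck_on_const) auto
    then show "Ck_on k S (\<lambda>x. - (inverse (f x) * frechet_derivative f (at x) v * inverse (f x)))"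
      by simp
  qed (use Suc in auto)
qed (auto intro!: continuous_on_inverse)

lemma Ck_on_prod:
  fixes f :: "'i \<Rightarrow> 'a::real_normed_vector \<Rightarrow> real"
  assumes "finite I" "\<And>i. i \<in> I \<Longrightarrow> Ck_on k S (f i)" "open S"
  shows "Ck_on k S (\<lambda>x. \<Prod>i\<in>I. f i x)"
  using assms by (induction I) (auto intro: Ck_on_const Ck_on_bilinear[OF bounded_bilinear_mult])

lemma Ck_on_vec_lambda:
  fixes f :: "'a::real_normed_vector \<Rightarrow> real^'n"
  assumes "\<And>i. Ck_on k S (\<lambda>x. f x $ i)" "open S"
  shows "Ck_on k S f"
proof -
  have "Ck_on k S (\<lambda>x. \<Sum>i\<in>UNIV. (f x $ i) *\<^sub>R axis i 1)"
    using assms by (intro Ck_on_sum Ck_on_bilinear[OF bounded_bilinear_scaleR] Ck_on_const) auto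
  then show ?thesis
    by (rule Ck_on_cong) (auto simp: \<open>open S\<close> vec_eq_iff axis_def if_distrib cong: if_cong)
qed

lemma Ck_on_det:
  fixes A :: "'a::real_normed_vector \<Rightarrow> real^'n^'n"
  assumes "\<And>i j. Ck_on k S (\<lambda>x. A x $ i $ j)" "open S"
  shows "Ck_on k S (\<lambda>x. det (A x))"
  unfolding det_def using assms
  by (intro Ck_on_sum Ck_on_bilinear[OF bounded_bilinear_mult] Ck_on_const Ck_on_prod) auto

lemma smooth_on_cong: "smooth_on S f \<Longrightarrow> open S \<Longrightarrow> (\<And>x. x \<in> S \<Longrightarrow> f x = g x) \<Longrightarrow> smooth_on S g"
  unfolding smooth_on_def using Ck_on_cong by blast

lemma smooth_on_subset: "smooth_on S f \<Longrightarrow> T \<subseteq> S \<Longrightarrow> smooth_on T f"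
  unfolding smooth_on_def using Ck_on_subset by blast

lemma smooth_on_local: "(\<And>x. x \<in> S \<Longrightarrow> \<exists>W. open W \<and> x \<in> W \<and> smooth_on W f) \<Longrightarrow> smooth_on S f"
  unfolding smooth_on_def by (meson Ck_on_local)

lemma smooth_on_const: "open S \<Longrightarrow> smooth_on S (\<lambda>x. c)"
  unfolding smooth_on_def using Ck_on_const by blast

lemma smooth_on_bounded_linear: "bounded_linear f \<Longrightarrow> open S \<Longrightarrow> smooth_on S f"
  unfolding smooth_on_def using Ck_on_bounded_linear by blast

lemma smooth_on_linear:
  fixes f :: "'a::euclidean_space \<Rightarrow> 'b::real_normed_vector"
  shows "linear f \<Longrightarrow> open S \<Longrightarrow> smooth_on S f"
  by (simp add: smooth_on_bounded_linear linear_conv_bounded_linear)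

lemma smooth_on_add: "smooth_on S f \<Longrightarrow> smooth_on S g \<Longrightarrow> open S \<Longrightarrow> smooth_on S (\<lambda>x. f x + g x)"
  unfolding smooth_on_def using Ck_on_add by blast

lemma smooth_on_bilinear:
  "bounded_bilinear B \<Longrightarrow> smooth_on S f \<Longrightarrow> smooth_on S g \<Longrightarrow> open S \<Longrightarrow> smooth_on S (\<lambda>x. B (f x) (g x))"
  unfolding smooth_on_def using Ck_on_bilinear by blast

lemmas smooth_on_scaleR = smooth_on_bilinear[OF bounded_bilinear_scaleR]
lemmas smooth_on_inner = smooth_on_bilinear[OF bounded_bilinear_inner]

lemma smooth_on_inverse:
  fixes f :: "'a::real_normed_vector \<Rightarrow> real"
  shows "smooth_on S f \<Longrightarrow> open S \<Longrightarrow> (\<And>x. x \<in> S \<Longrightarrow> f x \<noteq> 0) \<Longrightarrow> smooth_on S (\<lambda>x. inverse (f x))"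
  unfolding smooth_on_def using Ck_on_inverse by blast

lemma smooth_on_compose:
  fixes f :: "'b::euclidean_space \<Rightarrow> 'c::real_normed_vector"
  shows "smooth_on S g \<Longrightarrow> smooth_on W f \<Longrightarrow> g ` S \<subseteq> W \<Longrightarrow> open S \<Longrightarrow> open W \<Longrightarrow> smooth_on S (\<lambda>x. f (g x))"
  unfolding smooth_on_def using Ck_on_compose by blast

lemma smooth_on_imp_continuous_on: "smooth_on S f \<Longrightarrow> continuous_on S f"
  unfolding smooth_on_def by (metis Ck_on.simps(1))

lemma smooth_on_has_derivative:
  assumes "smooth_on S f" "x \<in> S"
  shows "(f has_derivative frechet_derivative f (at x)) (at x)"
  using assms Ck_on_has_derivative unfolding smooth_on_def by blast

lemma smooth_on_open_preimage:
  assumes "smooth_on S f" "open S" "open W"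
  shows "open {x \<in> S. f x \<in> W}"
  using continuous_open_preimage[OF smooth_on_imp_continuous_on] assms
  by (simp add: vimage_def Int_def)

text \<open>
  The curve is only assumed to be differentiable at the one parameter \<open>t\<close>, as in the definition of
  tangent vectors.
\<close>

lemma smooth_on_along_curve:
  assumes "smooth_on W F" "\<gamma> t \<in> W" "(\<gamma> has_vector_derivative v) (at t)"
  shows "((\<lambda>s. F (\<gamma> s)) has_vector_derivative frechet_derivative F (at (\<gamma> t)) v) (at t)"
  using vector_derivative_diff_chain_within[OF assms(3)
      has_derivative_at_withinI[OF smooth_on_has_derivative[OF assms(1,2)]]]
  by (simp add: o_def)

text \<open>
  Invariance of domain provides an open image and a continuous inverse \<open>g\<close>.  The derivative of \<open>g\<close> at
  \<open>y\<close> is inverse to that of \<open>h\<close> at \<open>g y\<close>; by Cramer's rule it is a rational expression in the partial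
  derivatives of \<open>h\<close> at \<open>g y\<close>, and so has as many continuous derivatives as \<open>g\<close> itself.  This gains
  one derivative at a time.
\<close>

lemma smooth_on_inverse_of_injective:
  fixes h :: "real^'n \<Rightarrow> real^'n"
  assumes "open W" "smooth_on W h" "inj_on h W"
    and surj: "\<And>z. z \<in> W \<Longrightarrow> surj (frechet_derivative h (at z))"
  shows "open (h ` W)" and "smooth_on (h ` W) (inv_into W h)"
proof -
  have Ck: "Ck_on k W h" for k
    using assms by (simp add: smooth_on_def)
  have cont: "continuous_on W h"
    using Ck[of 0] by simp
  show op: "open (h ` W)"
    using invariance_of_domain cont assms by blast
  let ?g = "inv_into W h"
  let ?D = "\<lambda>z. frechet_derivative h (at z)"
  have D: "(h has_derivative ?D z) (at z)" if "z \<in> W" for z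
    using Ck[of 1] that by (simp add: frechet_derivative_works)
  have lin: "linear (?D z)" if "z \<in> W" for z
    using D[OF that] by (rule has_derivative_linear)
  have gW: "?g y \<in> W" "h (?g y) = y" if "y \<in> h ` W" for y
    using that by (auto simp: inv_into_into f_inv_into_f)
  have gW_image: "?g ` h ` W \<subseteq> W"
    by (auto intro: inv_into_into)
  have gcont: "continuous_on (h ` W) ?g"
    using cont assms by (intro continuous_on_inverse_open) auto
  have "\<exists>G. linear G \<and> G \<circ> ?D z = id \<and> ?D z \<circ> G = id" if "z \<in> W" for z
    using linear_surjective_isomorphism[OF lin[OF that] surj[OF that]] by (auto simp: fun_eq_iff)
  then obtain G where G: "\<And>z. z \<in> W \<Longrightarrow> linear (G z) \<and> G z \<circ> ?D z = id \<and> ?D z \<circ> G z = id"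
    by metis
  have gD: "(?g has_derivative G (?g y)) (at y)" if "y \<in> h ` W" for y
  proof (rule has_derivative_inverse_basic)
    show "(h has_derivative ?D (?g y)) (at (?g y))"
      using D gW that by blast
    show "continuous (at y) ?g"
      using gcont op that continuous_on_eq_continuous_at by blast
    show "bounded_linear (G (?g y))"
      using G gW(1)[OF that] by (simp add: linear_conv_bounded_linear)
    show "G (?g y) \<circ> ?D (?g y) = id"
      using G gW(1)[OF that] by blast
  qed (use op that gW in auto)
  let ?A = "\<lambda>y. matrix (?D (?g y))"
  have det: "det (?A y) \<noteq> 0" if "y \<in> h ` W" for y
  proof -
    have "?A y ** matrix (G (?g y)) = mat 1"
      using G[OF gW(1)[OF that]] lin[OF gW(1)[OF that]]
      by (metis matrix_compose matrix_id_mat_1)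
    then show ?thesis
      by (metis det_I det_mul mult_zero_left zero_neq_one)
  qed
  have cramer_G: "G (?g y) v = (\<chi> k. det (\<chi> i j. if j = k then v $ i else ?A y $ i $ j) / det (?A y))"
    if "y \<in> h ` W" for y v
  proof -
    have "?A y *v G (?g y) v = v"
      using G[OF gW(1)[OF that]] lin[OF gW(1)[OF that]] by (simp add: matrix_works fun_eq_iff)
    then show ?thesis
      using cramer[OF det[OF that]] by blast
  qed
  have "Ck_on k (h ` W) ?g" for k
  proof (induction k)
    case 0
    then show ?case using gcont by simp
  next
    case (Suc k)
    show ?case
    proof (rule Ck_on_derivativeI[OF gD op])
      fix v
      have entry: "Ck_on k (h ` W) (\<lambda>y. ?A y $ i $ j)" for i j
      proof -
        have "Ck_on k W (\<lambda>z. ?D z (axis j 1))"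
          using Ck[of "Suc k"] by simp
        then have "Ck_on k (h ` W) (\<lambda>y. ?D (?g y) (axis j 1))"
          by (rule Ck_on_compose[OF Suc _ gW_image op assms(1)])
        then have "Ck_on k (h ` W) (\<lambda>y. ?D (?g y) (axis j 1) \<bullet> axis i 1)"
          using op by (intro Ck_on_bilinear[OF bounded_bilinear_inner] Ck_on_const) auto
        then show ?thesis
          by (simp add: matrix_def inner_axis)
      qed
      have "Ck_on k (h ` W) (\<lambda>y. \<chi> m. det (\<chi> i j. if j = m then v $ i else ?A y $ i $ j) * inverse (det (?A y)))"
      proof (rule Ck_on_vec_lambda[OF _ op])
        fix m
        have "Ck_on k (h ` W) (\<lambda>y. if j = m then v $ i else ?A y $ i $ j)" for i j
          using entry op by (cases "j = m") (auto intro: Ck_on_const)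
        then have "Ck_on k (h ` W) (\<lambda>y. det (\<chi> i j. if j = m then v $ i else ?A y $ i $ j))"
          by (intro Ck_on_det[OF _ op]) simp
        moreover have "Ck_on k (h ` W) (\<lambda>y. inverse (det (?A y)))"
          using entry det by (intro Ck_on_inverse Ck_on_det op)
        ultimately show "Ck_on k (h ` W) (\<lambda>y. (\<chi> m. det (\<chi> i j. if j = m then v $ i else ?A y $ i $ j)
            * inverse (det (?A y))) $ m)"
          unfolding vec_lambda_beta by (intro Ck_on_bilinear[OF bounded_bilinear_mult] op)
      qed
      then show "Ck_on k (h ` W) (\<lambda>y. G (?g y) v)"
        by (rule Ck_on_cong[OF _ op]) (simp only: cramer_G divide_inverse)
    qed auto
  qed
  then show "smooth_on (h ` W) ?g"
    by (simp add: smooth_on_def)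
qed

section \<open>Stereographic projection\<close>

text \<open>
  The poles of the two projections are \<open>axis 4 1\<close> and its negative, selected by \<open>\<epsilon> = 1\<close> and
  \<open>\<epsilon> = - 1\<close>.
\<close>

definition equatorial_part :: "real^4 \<Rightarrow> real^3" where
  "equatorial_part x = vector [x $ 1, x $ 2, x $ 3]"

definition equatorial_embedding :: "real^3 \<Rightarrow> real^4" where
  "equatorial_embedding y = y $ 1 *\<^sub>R axis 1 1 + y $ 2 *\<^sub>R axis 2 1 + y $ 3 *\<^sub>R axis 3 1"

definition stereo :: "real \<Rightarrow> real^4 \<Rightarrow> real^3" where
  "stereo \<epsilon> x = inverse (1 - \<epsilon> * x $ 4) *\<^sub>R equatorial_part x"

definition stereo_inv :: "real \<Rightarrow> real^3 \<Rightarrow> real^4" where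
  "stereo_inv \<epsilon> y = inverse (1 + y \<bullet> y) *\<^sub>R
     (2 *\<^sub>R equatorial_embedding y + (\<epsilon> * (y \<bullet> y - 1)) *\<^sub>R axis 4 1)"

definition stereo_domain :: "real \<Rightarrow> (real^4) set" where
  "stereo_domain \<epsilon> = {x. \<epsilon> * x $ 4 \<noteq> 1}"

lemma inner_vec_4: "(x::real^4) \<bullet> y = x $ 1 * y $ 1 + x $ 2 * y $ 2 + x $ 3 * y $ 3 + x $ 4 * y $ 4"
  by (simp add: inner_vec_def sum_4)

lemma inner_vec_3: "(x::real^3) \<bullet> y = x $ 1 * y $ 1 + x $ 2 * y $ 2 + x $ 3 * y $ 3"
  by (simp add: inner_vec_def sum_3)

lemma equatorial_simps [simp]:
  "equatorial_part x $ 1 = x $ 1" "equatorial_part x $ 2 = x $ 2" "equatorial_part x $ 3 = x $ 3"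
  "equatorial_embedding y $ 1 = y $ 1" "equatorial_embedding y $ 2 = y $ 2"
  "equatorial_embedding y $ 3 = y $ 3" "equatorial_embedding y $ 4 = 0"
  by (simp_all add: equatorial_part_def equatorial_embedding_def vector_3 axis_def)

lemma axis_4_simps [simp]:
  "axis (4::4) (1::real) $ 1 = 0" "axis (4::4) (1::real) $ 2 = 0" "axis (4::4) (1::real) $ 3 = 0"
  "axis (4::4) (1::real) $ 4 = 1"
  by (simp_all add: axis_def)

lemma linear_equatorial: "linear equatorial_part" "linear equatorial_embedding"
  by (auto intro!: linearI simp: vec_eq_iff forall_3 forall_4 algebra_simps)

lemma one_plus_inner_pos: "1 + (y::real^3) \<bullet> y > 0"
  by (simp add: add_pos_nonneg)

lemma stereo_inv_4: "stereo_inv \<epsilon> y $ 4 = \<epsilon> * (y \<bullet> y - 1) / (1 + y \<bullet> y)"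
  by (simp add: stereo_inv_def divide_inverse)

lemma stereo_inv_in_sphere:
  assumes "\<epsilon>\<^sup>2 = 1"
  shows "stereo_inv \<epsilon> y \<in> sphere 0 1"
proof -
  let ?r = "y \<bullet> y" and ?E = "equatorial_embedding y" and ?N = "axis 4 1 :: real^4"
  have "?E \<bullet> ?E = ?r" "?E \<bullet> ?N = 0" "?N \<bullet> ?N = 1"
    by (simp_all add: inner_vec_4 inner_vec_3)
  then have "stereo_inv \<epsilon> y \<bullet> stereo_inv \<epsilon> y
      = inverse (1 + ?r) * (inverse (1 + ?r) * (4 * ?r + (\<epsilon> * (?r - 1))\<^sup>2))"
    by (simp add: stereo_inv_def inner_add_left inner_add_right inner_commute[of ?N ?E] power2_eq_square)
      (simp add: distrib_left mult_ac)
  also have "\<dots> = (4 * ?r + \<epsilon>\<^sup>2 * (?r - 1)\<^sup>2) / (1 + ?r)\<^sup>2"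
    by (simp add: power_mult_distrib divide_inverse power2_eq_square)
  also have "\<dots> = (1 + ?r)\<^sup>2 / (1 + ?r)\<^sup>2"
    unfolding assms by (simp add: power2_eq_square algebra_simps)
  also have "\<dots> = 1"
    using one_plus_inner_pos[of y] by simp
  finally show ?thesis
    by (simp add: norm_eq_1)
qed

lemma stereo_inv_in_domain:
  assumes "\<epsilon>\<^sup>2 = 1"
  shows "stereo_inv \<epsilon> y \<in> stereo_domain \<epsilon>"
proof -
  have "\<epsilon> * stereo_inv \<epsilon> y $ 4 = (y \<bullet> y - 1) / (1 + y \<bullet> y)"
    using assms by (simp add: stereo_inv_4 power2_eq_square)
  also have "\<dots> \<noteq> 1"
    using one_plus_inner_pos[of y] by (simp add: field_simps)
  finally show ?thesis by (simp add: stereo_domain_def)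
qed

lemma stereo_stereo_inv:
  assumes "\<epsilon>\<^sup>2 = 1"
  shows "stereo \<epsilon> (stereo_inv \<epsilon> y) = y"
proof -
  have "1 - \<epsilon> * stereo_inv \<epsilon> y $ 4 = 2 * inverse (1 + y \<bullet> y)"
    using assms one_plus_inner_pos[of y] by (simp add: stereo_inv_4 power2_eq_square field_simps)
  then show ?thesis
    using one_plus_inner_pos[of y]
    by (simp add: stereo_def vec_eq_iff forall_3) (simp add: stereo_inv_def axis_def)
qed

lemma stereo_inv_stereo:
  assumes "\<epsilon>\<^sup>2 = 1" "x \<in> sphere 0 1" "x \<in> stereo_domain \<epsilon>"
  shows "stereo_inv \<epsilon> (stereo \<epsilon> x) = x"
proof -
  let ?d = "1 - \<epsilon> * x $ 4" and ?y = "stereo \<epsilon> x"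
  have d: "?d \<noteq> 0" using assms by (simp add: stereo_domain_def)
  have "x \<bullet> x = 1" using assms by (simp add: norm_eq_1)
  then have "x $ 1 * x $ 1 + x $ 2 * x $ 2 + x $ 3 * x $ 3 = 1 - \<epsilon>\<^sup>2 * (x $ 4)\<^sup>2"
    using assms by (simp add: inner_vec_4 power2_eq_square)
  also have "\<dots> = ?d * (1 + \<epsilon> * x $ 4)"
    by (simp add: algebra_simps power2_eq_square)
  finally have "equatorial_part x \<bullet> equatorial_part x = ?d * (1 + \<epsilon> * x $ 4)"
    by (simp add: inner_vec_3)
  then have "?y \<bullet> ?y = inverse ?d * (inverse ?d * (?d * (1 + \<epsilon> * x $ 4)))"
    by (simp add: stereo_def)
  then have r: "?y \<bullet> ?y = (1 + \<epsilon> * x $ 4) / ?d"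
    using d by (simp add: divide_inverse)
  have 1: "inverse (1 + ?y \<bullet> ?y) = ?d / 2"
    using d unfolding r by (simp add: field_simps)
  have 2: "stereo_inv \<epsilon> ?y $ 4 = \<epsilon>\<^sup>2 * x $ 4"
    using d unfolding stereo_inv_4 divide_inverse 1 unfolding r by (simp add: field_simps power2_eq_square)
  show ?thesis
    using d 2 assms(1) unfolding vec_eq_iff forall_4
    by (simp add: stereo_inv_def 1) (simp add: stereo_def)
qed

lemma open_stereo_domain: "open (stereo_domain \<epsilon>)"
proof -
  have "stereo_domain \<epsilon> = - {x. \<epsilon> * x $ 4 = 1}" by (auto simp: stereo_domain_def)
  then show ?thesis
    by (simp add: open_Compl closed_Collect_eq continuous_on_mult continuous_on_component)
qed

lemma smooth_on_stereo: "smooth_on (stereo_domain \<epsilon>) (stereo \<epsilon>)"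
proof -
  have "linear (\<lambda>x::real^4. (- \<epsilon>) * x $ 4)"
    by (auto intro!: linearI simp: algebra_simps)
  then have "smooth_on (stereo_domain \<epsilon>) (\<lambda>x. 1 + (- \<epsilon>) * x $ 4)"
    by (intro smooth_on_add smooth_on_const smooth_on_linear open_stereo_domain)
  then have "smooth_on (stereo_domain \<epsilon>) (\<lambda>x. inverse (1 + (- \<epsilon>) * x $ 4))"
    by (rule smooth_on_inverse[OF _ open_stereo_domain]) (auto simp: stereo_domain_def)
  then have "smooth_on (stereo_domain \<epsilon>) (\<lambda>x. inverse (1 + (- \<epsilon>) * x $ 4) *\<^sub>R equatorial_part x)"
    by (intro smooth_on_scaleR smooth_on_linear[OF linear_equatorial(1)] open_stereo_domain)
  then show ?thesis
    by (simp add: stereo_def[abs_def])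
qed

lemma smooth_on_stereo_inv: "smooth_on UNIV (stereo_inv \<epsilon>)"
proof -
  have r: "smooth_on UNIV (\<lambda>y::real^3. y \<bullet> y)"
    by (intro smooth_on_inner smooth_on_linear linear_id[unfolded id_def] open_UNIV)
  have "smooth_on UNIV (\<lambda>y::real^3. inverse (1 + y \<bullet> y) *\<^sub>R
     (2 *\<^sub>R equatorial_embedding y + (\<epsilon> * (y \<bullet> y + (- 1))) *\<^sub>R axis 4 1))"
    using one_plus_inner_pos
    by (intro smooth_on_scaleR smooth_on_inverse smooth_on_add smooth_on_const r smooth_on_linear
        smooth_on_bilinear[OF bounded_bilinear_mult] linear_equatorial open_UNIV) (simp add: less_imp_neq[symmetric])
  then show ?thesis
    by (simp add: stereo_inv_def[abs_def])
qed

lemma stereo_domains_cover: "x \<in> stereo_domain 1 \<or> x \<in> stereo_domain (- 1)"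
  by (auto simp: stereo_domain_def)

section \<open>Homogeneous spaces fibred over the three-sphere\<close>

lemma second_countable_euclidean: "second_countable (euclidean :: 'a::second_countable_topology topology)"
proof -
  obtain B :: "'a set set" where "countable B" "topological_basis B"
    using ex_countable_basis by blast
  then show ?thesis
    unfolding second_countable_def
    by (metis open_openin topological_basisE topological_basis_open)
qed

text \<open>
  What the argument needs to know about a group \<open>G\<close> acting on the three-sphere with stabilizer \<open>P\<close> of
  a point: \<open>\<pi>\<close> is the orbit map of the point, given on a neighbourhood of \<open>G\<close> so that it can serve as
  its own smooth extension.  Sections are required through every element of \<open>G\<close>, since a curve in
  \<open>G\<close> that starts at a given element and lies over a given curve is needed for the submersion
  property.
\<close>

locale fibration_over_sphere =
  fixes G P :: "(real^'n^'n) set" and \<pi> :: "real^'n^'n \<Rightarrow> real^4" and \<Omega> :: "(real^'n^'n) set"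
  assumes open_domain: "open \<Omega>" and group_in_domain: "G \<subseteq> \<Omega>"
    and smooth_proj: "smooth_on \<Omega> \<pi>"
    and group_nonempty: "G \<noteq> {}"
    and proj_in_sphere: "g \<in> G \<Longrightarrow> \<pi> g \<in> sphere 0 1"
    and fibres: "g \<in> G \<Longrightarrow> h \<in> G \<Longrightarrow> left_coset P g = left_coset P h \<longleftrightarrow> \<pi> g = \<pi> h"
    and section_through: "g \<in> G \<Longrightarrow>
      \<exists>\<tau>. smooth_on UNIV \<tau> \<and> (\<forall>x\<in>sphere 0 1. \<tau> x \<in> G \<and> \<pi> (\<tau> x) = x) \<and> \<tau> (\<pi> g) = g"
begin

abbreviation "S3 \<equiv> sphere (0 :: real^4) 1"

abbreviation "coset_top \<equiv> coset_topology G P"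

definition coset_point :: "(real^'n^'n) set \<Rightarrow> real^4" where
  "coset_point C = \<pi> (SOME g. g \<in> G \<and> left_coset P g = C)"

definition coset_over :: "real^4 \<Rightarrow> (real^'n^'n) set" where
  "coset_over x = left_coset P (SOME g. g \<in> G \<and> \<pi> g = x)"

lemma coset_point [simp]:
  assumes "g \<in> G" shows "coset_point (left_coset P g) = \<pi> g"
proof -
  let ?h = "SOME h. h \<in> G \<and> left_coset P h = left_coset P g"
  have "?h \<in> G \<and> left_coset P ?h = left_coset P g"
    by (rule someI[of _ g]) (use assms in auto)
  then show ?thesis
    using assms fibres by (auto simp: coset_point_def)
qed

lemma coset_over_proj [simp]:
  assumes "g \<in> G" shows "coset_over (\<pi> g) = left_coset P g"
proof -
  let ?h = "SOME h. h \<in> G \<and> \<pi> h = \<pi> g"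
  have "?h \<in> G \<and> \<pi> ?h = \<pi> g"
    by (rule someI[of _ g]) (use assms in auto)
  then show ?thesis
    using assms fibres by (auto simp: coset_over_def)
qed

lemma global_section:
  obtains \<tau> where "smooth_on UNIV \<tau>" "\<And>x. x \<in> S3 \<Longrightarrow> \<tau> x \<in> G" "\<And>x. x \<in> S3 \<Longrightarrow> \<pi> (\<tau> x) = x"
    "\<And>x. x \<in> S3 \<Longrightarrow> left_coset P (\<tau> x) = coset_over x"
proof -
  obtain g where "g \<in> G" using group_nonempty by blast
  then obtain \<tau> where "smooth_on UNIV \<tau>" "\<forall>x\<in>S3. \<tau> x \<in> G \<and> \<pi> (\<tau> x) = x"
    using section_through by blast
  then show ?thesis
    using coset_over_proj by (intro that[of \<tau>]) metis+
qed

lemma coset_over_in: "x \<in> S3 \<Longrightarrow> coset_over x \<in> coset_space G P"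
  by (metis global_section coset_space_def imageI)

lemma coset_point_over: "x \<in> S3 \<Longrightarrow> coset_point (coset_over x) = x"
  by (metis global_section coset_point)

lemma coset_point_in: "C \<in> coset_space G P \<Longrightarrow> coset_point C \<in> S3"
  using proj_in_sphere by (auto simp: coset_space_def)

lemma coset_over_point: "C \<in> coset_space G P \<Longrightarrow> coset_over (coset_point C) = C"
  by (auto simp: coset_space_def)

lemma topspace_coset_top: "topspace coset_top = coset_space G P"
proof -
  have "{g \<in> G. left_coset P g \<in> coset_space G P} = G"
    by (auto simp: coset_space_def)
  then have "openin coset_top (coset_space G P)"
    by (simp add: openin_coset_topology)
  then show ?thesis
    by (meson openin_coset_topology openin_subset openin_topspace subset_antisym)
qed

lemma continuous_coset_point: "continuous_map coset_top (top_of_set S3) coset_point"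
  unfolding continuous_map_def
proof (intro conjI allI impI)
  show "coset_point \<in> topspace coset_top \<rightarrow> topspace (top_of_set S3)"
    using coset_point_in by (auto simp: topspace_coset_top)
  fix W assume "openin (top_of_set S3) W"
  then obtain V where V: "open V" "W = S3 \<inter> V"
    by (auto simp: openin_open)
  have "{g \<in> G. left_coset P g \<in> {C \<in> coset_space G P. coset_point C \<in> W}} = G \<inter> {g \<in> \<Omega>. \<pi> g \<in> V}"
    using proj_in_sphere group_in_domain by (auto simp: V coset_space_def)
  moreover have "open {g \<in> \<Omega>. \<pi> g \<in> V}"
    using smooth_on_open_preimage smooth_proj open_domain V(1) by blast
  ultimately have "openin (top_of_set G) {g \<in> G. left_coset P g \<in> {C \<in> coset_space G P. coset_point C \<in> W}}"
    by (simp add: openin_open_Int)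
  then show "openin coset_top {C \<in> topspace coset_top. coset_point C \<in> W}"
    by (auto simp: openin_coset_topology topspace_coset_top)
qed

text \<open>
  The inverse of \<open>coset_point\<close> is a section followed by the quotient map; this replaces the usual
  appeal to compactness.
\<close>

lemma continuous_coset_over: "continuous_map (top_of_set S3) coset_top coset_over"
  unfolding continuous_map_def
proof (intro conjI allI impI)
  show "coset_over \<in> topspace (top_of_set S3) \<rightarrow> topspace coset_top"
    using coset_over_in by (auto simp: topspace_coset_top)
  fix U assume "openin coset_top U"
  then have "openin (top_of_set G) {g \<in> G. left_coset P g \<in> U}"
    by (simp add: openin_coset_topology)
  then obtain V where V: "open V" "{g \<in> G. left_coset P g \<in> U} = G \<inter> V"
    by (auto simp: openin_open)
  obtain \<tau> where \<tau>: "smooth_on UNIV \<tau>" "\<And>x. x \<in> S3 \<Longrightarrow> \<tau> x \<in> G"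
    "\<And>x. x \<in> S3 \<Longrightarrow> left_coset P (\<tau> x) = coset_over x"
    using global_section by metis
  have "coset_over x \<in> U \<longleftrightarrow> \<tau> x \<in> V" if "x \<in> S3" for x
  proof -
    have "\<tau> x \<in> {g \<in> G. left_coset P g \<in> U} \<longleftrightarrow> \<tau> x \<in> G \<inter> V"
      by (simp only: V(2))
    then show ?thesis
      using \<tau>(2,3)[OF that] by simp
  qed
  then have "{x \<in> topspace (top_of_set S3). coset_over x \<in> U} = S3 \<inter> {x \<in> UNIV. \<tau> x \<in> V}"
    by auto
  moreover have "open {x \<in> UNIV. \<tau> x \<in> V}"
    using smooth_on_open_preimage \<tau>(1) V(1) by blast
  ultimately show "openin (top_of_set S3) {x \<in> topspace (top_of_set S3). coset_over x \<in> U}"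
    by (simp add: openin_open_Int)
qed

lemma homeomorphic_coset_point: "homeomorphic_map coset_top (top_of_set S3) coset_point"
  unfolding homeomorphic_map_maps homeomorphic_maps_def
  using continuous_coset_point continuous_coset_over coset_point_over coset_over_point
  by (auto simp: topspace_coset_top)

lemma inj_on_coset_point: "U \<subseteq> coset_space G P \<Longrightarrow> inj_on coset_point U"
  by (rule inj_on_inverseI[of _ coset_over]) (rule coset_over_point, blast)

definition stereo_patch :: "real \<Rightarrow> (real^'n^'n) set set" where
  "stereo_patch \<epsilon> = {C \<in> coset_space G P. coset_point C \<in> stereo_domain \<epsilon>}"

definition stereo_chart :: "real \<Rightarrow> (real^'n^'n) set \<Rightarrow> real^3" where
  "stereo_chart \<epsilon> C = stereo \<epsilon> (coset_point C)"

definition stereo_atlas :: "((real^'n^'n) set set \<times> ((real^'n^'n) set \<Rightarrow> real^3)) set" where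
  "stereo_atlas = {(stereo_patch 1, stereo_chart 1), (stereo_patch (- 1), stereo_chart (- 1))}"

lemma homeomorphic_stereo_chart:
  assumes "\<epsilon>\<^sup>2 = 1"
  shows "homeomorphic_map (subtopology coset_top (stereo_patch \<epsilon>)) euclidean (stereo_chart \<epsilon>)"
proof -
  let ?D = "S3 \<inter> stereo_domain \<epsilon>"
  have "homeomorphic_map (subtopology coset_top (stereo_patch \<epsilon>)) (subtopology (top_of_set S3) (stereo_domain \<epsilon>)) coset_point"
  proof (rule homeomorphic_map_subtopologies_alt[OF homeomorphic_coset_point])
    fix C assume "C \<in> topspace coset_top" "coset_point C \<in> topspace (top_of_set S3)"
    then show "(coset_point C \<in> stereo_domain \<epsilon>) = (C \<in> stereo_patch \<epsilon>)"
      by (auto simp: stereo_patch_def topspace_coset_top)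
  qed
  then have 1: "homeomorphic_map (subtopology coset_top (stereo_patch \<epsilon>)) (top_of_set ?D) coset_point"
    by (simp add: subtopology_subtopology)
  have "continuous_on ?D (stereo \<epsilon>)"
    using smooth_on_imp_continuous_on[OF smooth_on_stereo] by (rule continuous_on_subset) auto
  then have "homeomorphic_maps (top_of_set ?D) euclidean (stereo \<epsilon>) (stereo_inv \<epsilon>)"
    unfolding homeomorphic_maps_def
    using smooth_on_imp_continuous_on[OF smooth_on_stereo_inv] assms
      stereo_inv_in_sphere stereo_inv_in_domain
    by (auto simp: stereo_stereo_inv stereo_inv_stereo continuous_map_in_subtopology)
  then have 2: "homeomorphic_map (top_of_set ?D) euclidean (stereo \<epsilon>)"
    using homeomorphic_map_maps by blast
  show ?thesis
    using homeomorphic_map_compose[OF 1 2] by (simp add: o_def stereo_chart_def[abs_def])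
qed

lemma stereo_atlas_cases:
  assumes "(U, \<phi>) \<in> stereo_atlas"
  obtains \<epsilon> where "\<epsilon>\<^sup>2 = 1" "U = stereo_patch \<epsilon>" "\<phi> = stereo_chart \<epsilon>"
  using assms by (auto simp: stereo_atlas_def intro: that[of 1] that[of "-1"])

lemma stereo_chart_over:
  assumes "\<epsilon>\<^sup>2 = 1"
  shows "coset_over (stereo_inv \<epsilon> y) \<in> stereo_patch \<epsilon>"
    and "stereo_chart \<epsilon> (coset_over (stereo_inv \<epsilon> y)) = y"
    and "C \<in> stereo_patch \<epsilon> \<Longrightarrow> coset_over (stereo_inv \<epsilon> (stereo_chart \<epsilon> C)) = C"
  using assms stereo_inv_in_sphere[OF assms, of y] stereo_inv_in_domain[OF assms, of y]
    coset_point_in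
  by (auto simp: stereo_patch_def stereo_chart_def coset_over_in coset_point_over stereo_stereo_inv
      stereo_inv_stereo coset_over_point simp del: mem_sphere mem_sphere_0)

lemma stereo_chart_image: "\<epsilon>\<^sup>2 = 1 \<Longrightarrow> stereo_chart \<epsilon> ` stereo_patch \<epsilon> = UNIV"
  using stereo_chart_over by (metis UNIV_eq_I imageI)

lemma inv_into_stereo_chart:
  assumes "\<epsilon>\<^sup>2 = 1"
  shows "inv_into (stereo_patch \<epsilon>) (stereo_chart \<epsilon>) y = coset_over (stereo_inv \<epsilon> y)"
proof (rule inv_into_f_eq)
  show "inj_on (stereo_chart \<epsilon>) (stereo_patch \<epsilon>)"
    by (rule inj_on_inverseI) (rule stereo_chart_over(3)[OF assms])
qed (use stereo_chart_over[OF assms] in auto)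

lemma smooth_stereo_transition:
  assumes "\<epsilon>\<^sup>2 = 1" "\<delta>\<^sup>2 = 1"
  shows "smooth_on (stereo_chart \<epsilon> ` (stereo_patch \<epsilon> \<inter> stereo_patch \<delta>))
    (stereo_chart \<delta> \<circ> inv_into (stereo_patch \<epsilon>) (stereo_chart \<epsilon>))"
proof -
  let ?W = "{y \<in> UNIV. stereo_inv \<epsilon> y \<in> stereo_domain \<delta>}"
  have W: "open ?W"
    using smooth_on_open_preimage[OF smooth_on_stereo_inv _ open_stereo_domain] by blast
  have "smooth_on ?W (\<lambda>y. stereo \<delta> (stereo_inv \<epsilon> y))"
    by (rule smooth_on_compose[OF smooth_on_subset[OF smooth_on_stereo_inv] smooth_on_stereo])
      (use W open_stereo_domain in auto)
  then have smooth: "smooth_on ?W (stereo_chart \<delta> \<circ> inv_into (stereo_patch \<epsilon>) (stereo_chart \<epsilon>))"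
  proof (rule smooth_on_cong[OF _ W])
    fix y assume "y \<in> ?W"
    then show "stereo \<delta> (stereo_inv \<epsilon> y)
        = (stereo_chart \<delta> \<circ> inv_into (stereo_patch \<epsilon>) (stereo_chart \<epsilon>)) y"
      using stereo_inv_in_sphere[OF assms(1), of y]
      by (simp add: inv_into_stereo_chart[OF assms(1)] stereo_chart_def coset_point_over del: mem_sphere mem_sphere_0)
  qed
  moreover have "stereo_chart \<epsilon> ` (stereo_patch \<epsilon> \<inter> stereo_patch \<delta>) \<subseteq> ?W"
    using assms stereo_inv_stereo coset_point_in
    by (auto simp: stereo_patch_def stereo_chart_def simp del: mem_sphere mem_sphere_0)
  ultimately show ?thesis
    by (rule smooth_on_subset)
qed

lemma smooth_manifold_stereo_atlas: "smooth_manifold coset_top stereo_atlas"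
  unfolding smooth_manifold_def smooth_atlas_def
proof (intro conjI ballI)
  have hom: "coset_top homeomorphic_space top_of_set S3"
    using homeomorphic_coset_point homeomorphic_map_imp_homeomorphic_space by blast
  show "Hausdorff_space coset_top"
    using homeomorphic_Hausdorff_space[OF hom] by (simp add: Hausdorff_space_subtopology)
  show "second_countable coset_top"
    using homeomorphic_space_second_countability[OF hom]
    by (simp add: second_countable_subtopology second_countable_euclidean)
  show "(\<Union>(U, \<phi>)\<in>stereo_atlas. U) = topspace coset_top"
    using stereo_domains_cover by (auto simp: stereo_atlas_def topspace_coset_top stereo_patch_def)
next
  fix c assume "c \<in> stereo_atlas"
  then obtain \<epsilon> where c: "\<epsilon>\<^sup>2 = 1" "c = (stereo_patch \<epsilon>, stereo_chart \<epsilon>)"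
    by (cases c) (auto elim: stereo_atlas_cases)
  have "openin coset_top {C \<in> topspace coset_top. coset_point C \<in> S3 \<inter> stereo_domain \<epsilon>}"
    by (rule openin_continuous_map_preimage[OF continuous_coset_point openin_open_Int[OF open_stereo_domain]])
  moreover have "{C \<in> topspace coset_top. coset_point C \<in> S3 \<inter> stereo_domain \<epsilon>} = stereo_patch \<epsilon>"
    using coset_point_in by (auto simp: stereo_patch_def topspace_coset_top simp del: mem_sphere mem_sphere_0)
  ultimately show "case c of (U, \<phi>) \<Rightarrow> openin coset_top U \<and> open (\<phi> ` U) \<and>
        homeomorphic_map (subtopology coset_top U) (top_of_set (\<phi> ` U)) \<phi>"
    using c stereo_chart_image homeomorphic_stereo_chart by auto
next
  fix c assume "c \<in> stereo_atlas"
  then show "case c of (U, \<phi>) \<Rightarrow>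
      \<forall>(V, \<psi>)\<in>stereo_atlas. smooth_on (\<phi> ` (U \<inter> V)) (\<psi> \<circ> inv_into U \<phi>)"
    using smooth_stereo_transition by (cases c) (auto elim!: stereo_atlas_cases)
qed

text \<open>
  To reach a given vector \<open>w\<close>, a straight line with velocity \<open>w\<close> in the chart is mapped to the sphere
  and lifted to the group by a section through \<open>g\<close>.
\<close>

lemma submersion_stereo_chart:
  assumes "\<epsilon>\<^sup>2 = 1"
  shows "smooth_submersion_on {g \<in> G. left_coset P g \<in> stereo_patch \<epsilon>}
    (\<lambda>g. stereo_chart \<epsilon> (left_coset P g))"
  unfolding smooth_submersion_on_def
proof
  let ?M = "{g \<in> G. left_coset P g \<in> stereo_patch \<epsilon>}"
  let ?F = "\<lambda>g. stereo \<epsilon> (\<pi> g)" and ?W = "{g \<in> \<Omega>. \<pi> g \<in> stereo_domain \<epsilon>}"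
  fix g assume "g \<in> ?M"
  then have g: "g \<in> G" "\<pi> g \<in> stereo_domain \<epsilon>" "g \<in> ?W"
    using group_in_domain by (auto simp: stereo_patch_def)
  have W: "open ?W"
    using smooth_on_open_preimage smooth_proj open_domain open_stereo_domain by blast
  have F: "smooth_on ?W ?F"
    by (rule smooth_on_compose[OF smooth_on_subset[OF smooth_proj] smooth_on_stereo])
      (use W open_stereo_domain in auto)
  have ext: "smooth_extension_at ?M g (\<lambda>g. stereo_chart \<epsilon> (left_coset P g)) ?F"
    unfolding smooth_extension_at_def
    using W F g by (intro exI[of _ ?W]) (auto simp: stereo_chart_def)
  have "w \<in> frechet_derivative ?F (at g) ` tangent_vectors ?M g" for w
  proof -
    obtain \<tau> where \<tau>: "smooth_on UNIV \<tau>" "\<And>x. x \<in> S3 \<Longrightarrow> \<tau> x \<in> G \<and> \<pi> (\<tau> x) = x" "\<tau> (\<pi> g) = g"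
      using section_through[OF g(1)] by blast
    let ?\<sigma> = "\<lambda>y. \<tau> (stereo_inv \<epsilon> y)" and ?l = "\<lambda>t. ?F g + t *\<^sub>R w"
    have \<sigma>: "smooth_on UNIV ?\<sigma>"
      using smooth_on_compose[OF smooth_on_stereo_inv \<tau>(1)] by simp
    have \<sigma>M: "?\<sigma> y \<in> ?M" "?F (?\<sigma> y) = y" for y
      using \<tau>(2)[OF stereo_inv_in_sphere[OF assms]] stereo_inv_in_domain[OF assms, of y]
      by (auto simp: stereo_patch_def coset_space_def stereo_stereo_inv assms)
    have \<sigma>0: "?\<sigma> (?l 0) = g"
      using g \<tau>(3) proj_in_sphere by (simp add: stereo_inv_stereo assms del: mem_sphere mem_sphere_0)
    have "(?l has_vector_derivative w) (at 0)"
      by (auto intro!: derivative_eq_intros)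
    then obtain v where v: "((\<lambda>t. ?\<sigma> (?l t)) has_vector_derivative v) (at 0)"
      using smooth_on_along_curve[OF \<sigma>] by blast
    then have "v \<in> tangent_vectors ?M g"
      unfolding tangent_vectors_def mem_Collect_eq[where a = v]
      using \<sigma>M(1) \<sigma>0 by (intro exI[of _ "\<lambda>t. ?\<sigma> (?l t)"] conjI allI)
    moreover have "((\<lambda>t. ?F (?\<sigma> (?l t))) has_vector_derivative frechet_derivative ?F (at g) v) (at 0)"
      using smooth_on_along_curve[OF F _ v] g(3) \<sigma>0 by simp
    then have "frechet_derivative ?F (at g) v = w"
      using \<open>(?l has_vector_derivative w) (at 0)\<close> vector_derivative_unique_at unfolding \<sigma>M(2) by blast
    ultimately show ?thesis by blast
  qed
  then show "\<exists>F. smooth_extension_at ?M g (\<lambda>g. stereo_chart \<epsilon> (left_coset P g)) F \<and>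
      frechet_derivative F (at g) ` tangent_vectors ?M g = UNIV"
    using ext by blast
qed

lemma quotient_atlas_stereo: "quotient_manifold_atlas G P stereo_atlas"
  unfolding quotient_manifold_atlas_def
  using smooth_manifold_stereo_atlas submersion_stereo_chart by (auto elim!: stereo_atlas_cases)

context
  fixes U :: "(real^'n^'n) set set" and \<phi> :: "(real^'n^'n) set \<Rightarrow> real^3"
  assumes U: "openin coset_top U"
    and chart: "homeomorphic_map (subtopology coset_top U) (top_of_set (\<phi> ` U)) \<phi>"
    and submersion: "smooth_submersion_on {g \<in> G. left_coset P g \<in> U} (\<lambda>g. \<phi> (left_coset P g))"
begin

lemma chart_domain_subset: "U \<subseteq> coset_space G P"
  using openin_subset[OF U] by (simp add: topspace_coset_top)

lemma chart_inj: "inj_on \<phi> U"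
  using homeomorphic_imp_injective_map[OF chart] openin_subset[OF U] by (simp add: Int_absorb1)

lemma coset_over_in_U: "x \<in> coset_point ` U \<Longrightarrow> x \<in> S3 \<and> coset_over x \<in> U"
  using chart_domain_subset by (auto simp: coset_over_point coset_point_in subset_iff simp del: mem_sphere mem_sphere_0)

text \<open>
  The chart is only known to be smooth after composition with the projection from \<open>G\<close>; precomposing
  with a section gives its smoothness as a function on the sphere.
\<close>

lemma chart_coset_over_smooth:
  assumes "x \<in> coset_point ` U"
  shows "\<exists>F V. open V \<and> x \<in> V \<and> smooth_on V F \<and> (\<forall>y\<in>coset_point ` U \<inter> V. F y = \<phi> (coset_over y))"
proof -
  let ?M = "{g \<in> G. left_coset P g \<in> U}"
  obtain \<tau> where \<tau>: "smooth_on UNIV \<tau>" "\<And>x. x \<in> S3 \<Longrightarrow> \<tau> x \<in> G"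
    "\<And>x. x \<in> S3 \<Longrightarrow> left_coset P (\<tau> x) = coset_over x"
    using global_section by metis
  have M: "\<tau> y \<in> ?M" if "y \<in> coset_point ` U" for y
    using \<tau>(2,3) coset_over_in_U[OF that] by auto
  obtain F W where F: "open W" "\<tau> x \<in> W" "smooth_on W F" "\<And>g. g \<in> ?M \<inter> W \<Longrightarrow> F g = \<phi> (left_coset P g)"
    using submersion M[OF assms] unfolding smooth_submersion_on_def smooth_extension_at_def by meson
  let ?V = "{y \<in> UNIV. \<tau> y \<in> W}"
  have V: "open ?V"
    using smooth_on_open_preimage[OF \<tau>(1) _ F(1)] by blast
  have "smooth_on ?V (\<lambda>y. F (\<tau> y))"
    by (rule smooth_on_compose[OF smooth_on_subset[OF \<tau>(1)] F(3)]) (use V F(1) in auto)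
  moreover have "F (\<tau> y) = \<phi> (coset_over y)" if "y \<in> coset_point ` U \<inter> ?V" for y
    using F(4)[of "\<tau> y"] M \<tau>(3) coset_over_in_U that by auto
  ultimately show ?thesis
    using V F(2) by (intro exI[of _ "\<lambda>y. F (\<tau> y)"] exI[of _ ?V]) auto
qed

lemma chart_smooth_on_sphere:
  "smooth_map_on (coset_point ` U) (\<phi> \<circ> inv_into U coset_point)"
  unfolding smooth_map_on_def
proof
  fix x assume "x \<in> coset_point ` U"
  then obtain F V where F: "open V" "x \<in> V" "smooth_on V F"
      "\<And>y. y \<in> coset_point ` U \<inter> V \<Longrightarrow> F y = \<phi> (coset_over y)"
    using chart_coset_over_smooth by meson
  have "inv_into U coset_point y = coset_over y" if "y \<in> coset_point ` U" for y
    using coset_over_in_U[OF that] coset_point_over inj_on_coset_point[OF chart_domain_subset]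
    by (intro inv_into_f_eq) auto
  then show "\<exists>F. smooth_extension_at (coset_point ` U) x (\<phi> \<circ> inv_into U coset_point) F"
    unfolding smooth_extension_at_def using F by (intro exI[of _ F] exI[of _ V]) auto
qed

text \<open>
  Near a point of the chart domain, \<open>h\<close> is the chart read in stereographic coordinates.  It is smooth
  and injective, and its inverse gives the claim once its derivative is known to be onto.  For the
  latter, every vector \<open>w\<close> is the velocity of the chart along some curve \<open>\<gamma>\<close> in \<open>G\<close>, by the
  submersion property; along this curve the chart equals \<open>h\<close> composed with the stereographic image
  \<open>q\<close> of \<open>\<gamma>\<close>, so that \<open>w\<close> is a value of the derivative of \<open>h\<close>.
\<close>

lemma chart_inverse_smooth: "smooth_on (\<phi> ` U) (coset_point \<circ> inv_into U \<phi>)"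
proof (rule smooth_on_local)
  fix y0 assume "y0 \<in> \<phi> ` U"
  then obtain C0 where C0: "C0 \<in> U" "y0 = \<phi> C0" by blast
  obtain \<epsilon> where \<epsilon>: "\<epsilon>\<^sup>2 = 1" "coset_point C0 \<in> stereo_domain \<epsilon>"
    using stereo_domains_cover[of "coset_point C0"] by (metis one_power2 power2_minus)
  have "openin (top_of_set S3) (coset_point ` U)"
    using homeomorphic_imp_open_map[OF homeomorphic_coset_point] U by (auto simp: open_map_def)
  then obtain V where V: "open V" "coset_point ` U = S3 \<inter> V"
    by (auto simp: openin_open)
  let ?p = "stereo_inv \<epsilon>"
  let ?O = "{z. ?p z \<in> coset_point ` U}" and ?h = "\<lambda>z. \<phi> (coset_over (?p z))"
  have "?O = {z \<in> UNIV. ?p z \<in> V}"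
    using stereo_inv_in_sphere[OF \<epsilon>(1)] by (auto simp: V(2) simp del: mem_sphere mem_sphere_0)
  then have O: "open ?O"
    using smooth_on_open_preimage[OF smooth_on_stereo_inv _ V(1)] by simp
  have smooth: "smooth_on ?O ?h"
  proof (rule smooth_on_local)
    fix z assume z: "z \<in> ?O"
    then obtain F W where F: "open W" "?p z \<in> W" "smooth_on W F"
        "\<And>y. y \<in> coset_point ` U \<inter> W \<Longrightarrow> F y = \<phi> (coset_over y)"
      using chart_coset_over_smooth[of "?p z"] by blast
    let ?Z = "?O \<inter> {z \<in> UNIV. ?p z \<in> W}"
    have Z: "open ?Z"
      using O smooth_on_open_preimage[OF smooth_on_stereo_inv _ F(1)] by blast
    have "smooth_on ?Z (\<lambda>z. F (?p z))"
      by (rule smooth_on_compose[OF smooth_on_subset[OF smooth_on_stereo_inv] F(3)]) (use Z F(1) in auto)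
    then have "smooth_on ?Z ?h"
      by (rule smooth_on_cong[OF _ Z]) (use F(4) in auto)
    then show "\<exists>W. open W \<and> z \<in> W \<and> smooth_on W ?h"
      using Z z F(2) by (intro exI[of _ ?Z]) auto
  qed
  have inj: "inj_on ?h ?O"
  proof (rule inj_onI)
    fix z w assume zw: "z \<in> ?O" "w \<in> ?O" "?h z = ?h w"
    then have "coset_over (?p z) = coset_over (?p w)"
      using coset_over_in_U chart_inj by (auto simp: inj_on_eq_iff)
    then have "?p z = ?p w"
      using stereo_inv_in_sphere[OF \<epsilon>(1)] coset_point_over by metis
    then show "z = w"
      using stereo_stereo_inv[OF \<epsilon>(1)] by metis
  qed
  have surj: "surj (frechet_derivative ?h (at z))" if z: "z \<in> ?O" for z
  proof -
    let ?M = "{g \<in> G. left_coset P g \<in> U}"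
    obtain g where g: "g \<in> G" "\<pi> g = ?p z" "left_coset P g = coset_over (?p z)"
      using global_section stereo_inv_in_sphere[OF \<epsilon>(1)] by metis
    then have "g \<in> ?M"
      using z coset_over_in_U by auto
    then obtain F where F: "smooth_extension_at ?M g (\<lambda>g. \<phi> (left_coset P g)) F"
        and onto: "frechet_derivative F (at g) ` tangent_vectors ?M g = UNIV"
      using submersion unfolding smooth_submersion_on_def by blast
    obtain W where W: "open W" "g \<in> W" "smooth_on W F" "\<And>g. g \<in> ?M \<inter> W \<Longrightarrow> F g = \<phi> (left_coset P g)"
      using F unfolding smooth_extension_at_def by blast
    have "w \<in> range (frechet_derivative ?h (at z))" for w
    proof -
      obtain v \<gamma> where \<gamma>: "frechet_derivative F (at g) v = w" "\<And>t::real. \<gamma> t \<in> ?M" "\<gamma> 0 = g"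
          "(\<gamma> has_vector_derivative v) (at 0)"
        using onto unfolding tangent_vectors_def by (smt (verit) UNIV_I imageE mem_Collect_eq)
      let ?q = "\<lambda>t. stereo \<epsilon> (\<pi> (\<gamma> t))"
      have q0: "?q 0 = z"
        by (simp add: \<gamma>(3) g(2) stereo_stereo_inv \<epsilon>(1))
      have "((\<lambda>t. \<pi> (\<gamma> t)) has_vector_derivative frechet_derivative \<pi> (at g) v) (at 0)"
        using smooth_on_along_curve[OF smooth_proj _ \<gamma>(4)] g(1) group_in_domain \<gamma>(3) by auto
      then have "(?q has_vector_derivative
          frechet_derivative (stereo \<epsilon>) (at (?p z)) (frechet_derivative \<pi> (at g) v)) (at 0)"
        using smooth_on_along_curve[OF smooth_on_stereo, of "\<lambda>t. \<pi> (\<gamma> t)" 0] stereo_inv_in_domain[OF \<epsilon>(1)]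
        by (simp add: \<gamma>(3) g(2))
      then obtain u where u: "((\<lambda>t. ?h (?q t)) has_vector_derivative frechet_derivative ?h (at z) u) (at 0)"
        using smooth_on_along_curve[OF smooth, of ?q 0] z unfolding q0 by blast
      have Fw: "((\<lambda>t. F (\<gamma> t)) has_vector_derivative w) (at 0)"
        using smooth_on_along_curve[OF W(3) _ \<gamma>(4)] W(2) by (simp add: \<gamma>(1,3))
      \<comment> \<open>Near the parameter 0 the curve stays where both the extension and the projection are defined.\<close>
      let ?N = "W \<inter> {h \<in> \<Omega>. \<pi> h \<in> stereo_domain \<epsilon>}"
      have "open ?N"
        using W(1) smooth_on_open_preimage smooth_proj open_domain open_stereo_domain by blast
      moreover have "\<gamma> 0 \<in> ?N"
        using W(2) g(1,2) group_in_domain stereo_inv_in_domain[OF \<epsilon>(1)] by (auto simp: \<gamma>(3))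
      moreover have "isCont \<gamma> 0"
        using \<gamma>(4) has_vector_derivative_continuous by blast
      ultimately have "eventually (\<lambda>t. \<gamma> t \<in> ?N) (at 0)"
        unfolding isCont_def by (blast intro: topological_tendstoD)
      then obtain d where d: "d > 0" "\<And>t. t \<noteq> 0 \<Longrightarrow> dist t 0 < d \<Longrightarrow> \<gamma> t \<in> ?N"
        by (auto simp: eventually_at)
      have eq: "F (\<gamma> t) = ?h (?q t)" if "dist t 0 < d" for t
      proof -
        have N: "\<gamma> t \<in> ?N"
          using d(2)[OF _ that] \<open>\<gamma> 0 \<in> ?N\<close> by (cases "t = 0") auto
        have "\<gamma> t \<in> G" using \<gamma>(2) by blast
        then have "?p (?q t) = \<pi> (\<gamma> t)"
          using N proj_in_sphere by (intro stereo_inv_stereo \<epsilon>(1)) auto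
        then show ?thesis
          using W(4)[of "\<gamma> t"] \<gamma>(2)[of t] N by simp
      qed
      have "((\<lambda>t. ?h (?q t)) has_vector_derivative w) (at 0)"
        using Fw unfolding has_vector_derivative_def
        by (rule has_derivative_transform_within[OF _ d(1)]) (use eq in auto)
      then have "w = frechet_derivative ?h (at z) u"
        using u vector_derivative_unique_at by blast
      then show ?thesis by blast
    qed
    then show ?thesis by blast
  qed
  note inverse = smooth_on_inverse_of_injective[OF O smooth inj surj]
  have "smooth_on (?h ` ?O) (\<lambda>y. ?p (inv_into ?O ?h y))"
    by (rule smooth_on_compose[OF inverse(2) smooth_on_stereo_inv]) (use inverse(1) in auto)
  then have "smooth_on (?h ` ?O) (coset_point \<circ> inv_into U \<phi>)"
  proof (rule smooth_on_cong[OF _ inverse(1)])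
    fix y assume "y \<in> ?h ` ?O"
    then obtain z where z: "z \<in> ?O" "y = ?h z" by blast
    have "inv_into U \<phi> y = coset_over (?p z)"
      using z coset_over_in_U chart_inj by (intro inv_into_f_eq) auto
    moreover have "inv_into ?O ?h y = z"
      using z inj by (intro inv_into_f_eq) auto
    ultimately show "?p (inv_into ?O ?h y) = (coset_point \<circ> inv_into U \<phi>) y"
      using coset_point_over[OF stereo_inv_in_sphere[OF \<epsilon>(1)]] by simp
  qed
  moreover have "y0 \<in> ?h ` ?O"
  proof (rule image_eqI[of _ _ "stereo \<epsilon> (coset_point C0)"])
    have "?p (stereo \<epsilon> (coset_point C0)) = coset_point C0"
      using C0 chart_domain_subset coset_point_in \<epsilon> by (intro stereo_inv_stereo) auto
    then show "y0 = ?h (stereo \<epsilon> (coset_point C0))" "stereo \<epsilon> (coset_point C0) \<in> ?O"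
      using C0 chart_domain_subset coset_over_point by auto
  qed
  ultimately show "\<exists>W. open W \<and> y0 \<in> W \<and> smooth_on W (coset_point \<circ> inv_into U \<phi>)"
    using inverse(1) by blast
qed

end

lemma quotient_diffeomorphic_sphere:
  fixes A :: "((real^'n^'n) set set \<times> ((real^'n^'n) set \<Rightarrow> real^3)) set"
  assumes "quotient_manifold_atlas G P A"
  shows "diffeomorphic_to_submanifold coset_top A S3"
  unfolding diffeomorphic_to_submanifold_def
proof (intro conjI exI[of _ coset_point])
  show A: "smooth_manifold coset_top A"
    using assms by (simp add: quotient_manifold_atlas_def)
  show "homeomorphic_map coset_top (top_of_set S3) coset_point"
    by (rule homeomorphic_coset_point)
  show "\<forall>(U, \<phi>)\<in>A. smooth_on (\<phi> ` U) (coset_point \<circ> inv_into U \<phi>) \<and>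
                     smooth_map_on (coset_point ` U) (\<phi> \<circ> inv_into U coset_point)"
  proof (clarify)
    fix U \<phi> assume U: "(U, \<phi>) \<in> A"
    have "openin coset_top U" "homeomorphic_map (subtopology coset_top U) (top_of_set (\<phi> ` U)) \<phi>"
      using A U unfolding smooth_manifold_def smooth_atlas_def by auto
    moreover have "smooth_submersion_on {g \<in> G. left_coset P g \<in> U} (\<lambda>g. \<phi> (left_coset P g))"
      using assms U unfolding quotient_manifold_atlas_def by auto
    ultimately show "smooth_on (\<phi> ` U) (coset_point \<circ> inv_into U \<phi>) \<and>
                     smooth_map_on (coset_point ` U) (\<phi> \<circ> inv_into U coset_point)"
      using chart_inverse_smooth chart_smooth_on_sphere by blast
  qed
qed

end

section \<open>The Lorentz form and its group\<close>

lemma exhaust_5: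
  fixes i :: 5
  shows "i = 1 \<or> i = 2 \<or> i = 3 \<or> i = 4 \<or> i = 5"
proof (induct i)
  case (of_int z)
  then have "z = 0 \<or> z = 1 \<or> z = 2 \<or> z = 3 \<or> z = 4" by fastforce
  then show ?case by auto
qed

lemma forall_5: "(\<forall>i::5. Q i) \<longleftrightarrow> Q 1 \<and> Q 2 \<and> Q 3 \<and> Q 4 \<and> Q 5"
  by (metis exhaust_5)

lemma UNIV_5: "UNIV = {1, 2, 3, 4, 5::5}"
  using exhaust_5 by auto

lemma sum_5: "sum f (UNIV :: 5 set) = f 1 + f 2 + f 3 + f 4 + f 5"
  unfolding UNIV_5 by (simp add: ac_simps)

definition spacetime :: "real \<Rightarrow> real^4 \<Rightarrow> real^5" where
  "spacetime t x = (\<chi> i. if i = 1 then t else if i = 2 then x $ 1 else if i = 3 then x $ 2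
     else if i = 4 then x $ 3 else x $ 4)"

definition spatial :: "real^5 \<Rightarrow> real^4" where
  "spatial u = (\<chi> i. if i = 1 then u $ 2 else if i = 2 then u $ 3 else if i = 3 then u $ 4 else u $ 5)"

definition lorentz :: "real^5 \<Rightarrow> real^5 \<Rightarrow> real" where
  "lorentz u w = u $ 1 * w $ 1 - spatial u \<bullet> spatial w"

abbreviation light :: "real^4 \<Rightarrow> real^5" where
  "light x \<equiv> spacetime 1 x"

lemma spacetime_components [simp]:
  "spacetime t x $ 1 = t" "spacetime t x $ 2 = x $ 1" "spacetime t x $ 3 = x $ 2"
  "spacetime t x $ 4 = x $ 3" "spacetime t x $ 5 = x $ 4"
  by (simp_all add: spacetime_def)

lemma spatial_components:
  "spatial u $ 1 = u $ 2" "spatial u $ 2 = u $ 3" "spatial u $ 3 = u $ 4" "spatial u $ 4 = u $ 5"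
  by (simp_all add: spatial_def)

lemma spatial_spacetime [simp]: "spatial (spacetime t x) = x"
  by (simp add: vec_eq_iff forall_4 spatial_components)

lemma spacetime_spatial [simp]: "spacetime (u $ 1) (spatial u) = u"
  by (simp add: vec_eq_iff forall_5 spatial_components)

lemma spacetime_eq_iff: "u = w \<longleftrightarrow> u $ 1 = w $ 1 \<and> spatial u = spatial w"
  by (metis spacetime_spatial)

lemma spatial_linear [simp]:
  "spatial (u + w) = spatial u + spatial w" "spatial (u - w) = spatial u - spatial w"
  "spatial (c *\<^sub>R u) = c *\<^sub>R spatial u" "spatial (- u) = - spatial u" "spatial 0 = 0"
  by (simp_all add: vec_eq_iff forall_4 spatial_components)

lemma linear_spatial: "linear spatial"
  by (auto intro: linearI)

lemma spacetime_eq_0_iff [simp]: "spacetime t x = 0 \<longleftrightarrow> t = 0 \<and> x = 0"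
  by (simp add: spacetime_eq_iff)

lemma lorentz_linear:
  "lorentz (u + w) z = lorentz u z + lorentz w z" "lorentz z (u + w) = lorentz z u + lorentz z w"
  "lorentz (u - w) z = lorentz u z - lorentz w z" "lorentz z (u - w) = lorentz z u - lorentz z w"
  "lorentz (c *\<^sub>R u) z = c * lorentz u z" "lorentz z (c *\<^sub>R u) = c * lorentz z u"
  by (simp_all add: lorentz_def inner_add_left inner_add_right inner_diff_left inner_diff_right algebra_simps)

lemma lorentz_commute: "lorentz u w = lorentz w u"
  by (simp add: lorentz_def inner_commute)

text \<open>
  With this identity, membership in the group and in its Lie algebra becomes invariance and skewness of
  the bilinear form \<open>lorentz\<close>, and no matrix entries have to be computed.
\<close>

lemma lorentz_form_inner: "u \<bullet> (lorentz_form *v w) = lorentz u w"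
proof -
  have "lorentz_form *v w = (\<chi> i. if i = 1 then w $ 1 else - w $ i)"
    by (simp add: vec_eq_iff forall_5 matrix_vector_mult_def lorentz_form_def sum_5)
  then show ?thesis
    by (simp add: lorentz_def inner_vec_4 inner_vec_def[of u] sum_5 spatial_components)
qed

lemma matrix_eq_inner:
  fixes A B :: "real^'n^'n"
  shows "A = B \<longleftrightarrow> (\<forall>u w. u \<bullet> (A *v w) = u \<bullet> (B *v w))"
  by (metis matrix_eq vector_eq_ldot)

lemma preserves_lorentz_form_iff:
  "transpose A ** lorentz_form ** A = lorentz_form \<longleftrightarrow> (\<forall>u w. lorentz (A *v u) (A *v w) = lorentz u w)"
proof -
  have "u \<bullet> ((transpose A ** lorentz_form ** A) *v w) = lorentz (A *v u) (A *v w)" for u w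
    by (simp add: matrix_vector_mul_assoc[symmetric] lorentz_form_inner[symmetric])
      (metis dot_lmul_matrix inner_commute)
  then show ?thesis
    by (simp add: matrix_eq_inner[of _ lorentz_form] lorentz_form_inner)
qed

lemma full_SO14_iff: "A \<in> full_SO14 \<longleftrightarrow> det A = 1 \<and> (\<forall>u w. lorentz (A *v u) (A *v w) = lorentz u w)"
  by (simp add: full_SO14_def preserves_lorentz_form_iff)

lemma so14_iff: "X \<in> so14 \<longleftrightarrow> (\<forall>u w. lorentz (X *v u) w = - lorentz u (X *v w))"
proof -
  have "u \<bullet> ((transpose X ** lorentz_form + lorentz_form ** X) *v w) = lorentz (X *v u) w + lorentz u (X *v w)" for u w
    by (simp add: matrix_vector_mul_assoc[symmetric] matrix_vector_mult_add_rdistrib inner_add_right lorentz_form_inner)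
      (metis dot_lmul_matrix inner_commute lorentz_form_inner)
  then show ?thesis
    by (simp add: so14_def matrix_eq_inner[of _ 0] eq_neg_iff_add_eq_0)
qed

lemma full_SO14_mult: "A \<in> full_SO14 \<Longrightarrow> B \<in> full_SO14 \<Longrightarrow> A ** B \<in> full_SO14"
  by (simp add: full_SO14_iff det_mul matrix_vector_mul_assoc[symmetric])

lemma matrix_inv_inverse:
  fixes A :: "real^'n^'n"
  assumes "invertible A"
  shows "A ** matrix_inv A = mat 1" "matrix_inv A ** A = mat 1"
  using assms someI_ex[of "\<lambda>B. A ** B = mat 1 \<and> B ** A = mat 1"]
  by (auto simp: invertible_def matrix_inv_def)

lemma matrix_inv_unique:
  fixes A B :: "real^'n^'n"
  assumes "A ** B = mat 1"
  shows "matrix_inv A = B"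
proof -
  have "invertible A"
    using assms invertible_right_inverse by blast
  then have "matrix_inv A ** (A ** B) = B"
    by (simp add: matrix_mul_assoc matrix_inv_inverse)
  then show ?thesis
    by (simp add: assms)
qed

lemma full_SO14_inverse:
  assumes "A \<in> full_SO14"
  shows "matrix_inv A ** A = mat 1" "A ** matrix_inv A = mat 1" "matrix_inv A \<in> full_SO14"
proof -
  have "invertible A"
    using assms by (simp add: full_SO14_iff invertible_det_nz)
  then show inv: "matrix_inv A ** A = mat 1" "A ** matrix_inv A = mat 1"
    by (simp_all add: matrix_inv_inverse)
  have "det (matrix_inv A) = 1"
    using arg_cong[OF inv(1), of det] assms by (simp add: det_mul full_SO14_iff)
  moreover have "lorentz (matrix_inv A *v u) (matrix_inv A *v w) = lorentz u w" for u w
  proof -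
    have "lorentz (A *v (matrix_inv A *v u)) (A *v (matrix_inv A *v w))
        = lorentz (matrix_inv A *v u) (matrix_inv A *v w)"
      using assms full_SO14_iff by blast
    then show ?thesis
      by (simp add: matrix_vector_mul_assoc inv)
  qed
  ultimately show "matrix_inv A \<in> full_SO14"
    by (simp add: full_SO14_iff)
qed

lemma mat_1_full: "mat 1 \<in> full_SO14"
  by (simp add: full_SO14_iff)

lemma SO14_subset: "SO14 \<subseteq> full_SO14"
  unfolding SO14_def by (rule connected_component_subset)

text \<open>
  This is how elements are shown to lie in the identity component: they are put into a connected
  subset of the full group that meets it.
\<close>

lemma connected_in_SO14: "connected S \<Longrightarrow> S \<subseteq> full_SO14 \<Longrightarrow> S \<inter> SO14 \<noteq> {} \<Longrightarrow> S \<subseteq> SO14"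
  unfolding SO14_def by (metis connected_component_eq connected_component_maximal disjoint_iff)

lemma mat_1_SO14: "mat 1 \<in> SO14"
  unfolding SO14_def using mat_1_full by simp

lemma connected_translate:
  fixes A :: "real^'n^'n"
  shows "connected S \<Longrightarrow> connected ((**) A ` S)"
  by (intro connected_continuous_image linear_continuous_on)
    (auto simp: linear_conv_bounded_linear[symmetric] matrix_add_ldistrib intro!: linearI
      simp: matrix_scalar_ac scalar_matrix_assoc[symmetric])

lemma SO14_mult:
  assumes "A \<in> SO14" "B \<in> SO14"
  shows "A ** B \<in> SO14"
proof -
  have "(**) A ` SO14 \<subseteq> SO14"
  proof (rule connected_in_SO14)
    show "connected ((**) A ` SO14)"
      unfolding SO14_def by (intro connected_translate connected_connected_component)
    show "(**) A ` SO14 \<subseteq> full_SO14"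
      using SO14_subset assms full_SO14_mult by blast
    have "A ** mat 1 \<in> (**) A ` SO14"
      using mat_1_SO14 by blast
    then show "(**) A ` SO14 \<inter> SO14 \<noteq> {}"
      using assms by auto
  qed
  then show ?thesis
    using assms by blast
qed

lemma SO14_inverse:
  assumes "A \<in> SO14"
  shows "matrix_inv A ** A = mat 1" "A ** matrix_inv A = mat 1" "matrix_inv A \<in> SO14"
proof -
  have A: "A \<in> full_SO14"
    using assms SO14_subset by blast
  then show inv: "matrix_inv A ** A = mat 1" "A ** matrix_inv A = mat 1"
    by (rule full_SO14_inverse)+
  let ?S = "(**) (matrix_inv A) ` SO14"
  have "?S \<subseteq> SO14"
  proof (rule connected_in_SO14)
    show "connected ?S"
      unfolding SO14_def by (intro connected_translate connected_connected_component)
    show "?S \<subseteq> full_SO14"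
      using SO14_subset full_SO14_inverse(3)[OF A] full_SO14_mult by blast
    have "matrix_inv A ** A \<in> ?S"
      using assms by blast
    then show "?S \<inter> SO14 \<noteq> {}"
      using mat_1_SO14 by (auto simp: inv)
  qed
  moreover have "matrix_inv A ** mat 1 \<in> ?S"
    using mat_1_SO14 by blast
  ultimately show "matrix_inv A \<in> SO14"
    by auto
qed

lemma SO14_lorentz: "A \<in> SO14 \<Longrightarrow> lorentz (A *v u) (A *v w) = lorentz u w"
  using SO14_subset full_SO14_iff by blast

lemma SO14_cancel [simp]:
  assumes "A \<in> SO14"
  shows "matrix_inv A *v (A *v u) = u" "A *v (matrix_inv A *v u) = u"
    "matrix_inv A ** (A ** B) = B" "A ** (matrix_inv A ** B) = B"
  by (simp_all add: matrix_vector_mul_assoc matrix_mul_assoc SO14_inverse[OF assms])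


section \<open>Rotations by unit quaternions\<close>

text \<open>
  The product of quaternions, with real part in the coordinate \<open>1\<close>.
\<close>

definition qmul :: "real^4 \<Rightarrow> real^4 \<Rightarrow> real^4" where
  "qmul x y = (\<chi> i.
     if i = 1 then x $ 1 * y $ 1 - x $ 2 * y $ 2 - x $ 3 * y $ 3 - x $ 4 * y $ 4
     else if i = 2 then x $ 1 * y $ 2 + x $ 2 * y $ 1 + x $ 3 * y $ 4 - x $ 4 * y $ 3
     else if i = 3 then x $ 1 * y $ 3 - x $ 2 * y $ 4 + x $ 3 * y $ 1 + x $ 4 * y $ 2
     else x $ 1 * y $ 4 + x $ 2 * y $ 3 - x $ 3 * y $ 2 + x $ 4 * y $ 1)"

lemma qmul_components:
  "qmul x y $ 1 = x $ 1 * y $ 1 - x $ 2 * y $ 2 - x $ 3 * y $ 3 - x $ 4 * y $ 4"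
  "qmul x y $ 2 = x $ 1 * y $ 2 + x $ 2 * y $ 1 + x $ 3 * y $ 4 - x $ 4 * y $ 3"
  "qmul x y $ 3 = x $ 1 * y $ 3 - x $ 2 * y $ 4 + x $ 3 * y $ 1 + x $ 4 * y $ 2"
  "qmul x y $ 4 = x $ 1 * y $ 4 + x $ 2 * y $ 3 - x $ 3 * y $ 2 + x $ 4 * y $ 1"
  by (simp_all add: qmul_def)

lemma qmul_inner: "qmul x y \<bullet> qmul x z = (x \<bullet> x) * (y \<bullet> z)"
  unfolding inner_vec_4 qmul_components by algebra

lemma qmul_one: "qmul x (axis 1 1) = x" "qmul (axis 1 1) y = y"
  by (simp_all add: vec_eq_iff forall_4 qmul_components axis_def)

lemma qmul_linear_right: "linear (qmul x)"
  by (rule linearI) (simp_all add: vec_eq_iff forall_4 qmul_components algebra_simps)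

lemma qmul_linear_left: "linear (\<lambda>x. qmul x y)"
  by (rule linearI) (simp_all add: vec_eq_iff forall_4 qmul_components algebra_simps)

definition qrotation :: "real^4 \<Rightarrow> real^5^5" where
  "qrotation x = matrix (\<lambda>u. spacetime (u $ 1) (qmul x (spatial u)))"

lemma linear_spacetime_map:
  assumes "linear f"
  shows "linear (\<lambda>u. spacetime (u $ 1) (f (spatial u)))"
  using assms by (intro linearI) (simp_all add: spacetime_eq_iff linear_add linear_cmul)

lemma qrotation_apply: "qrotation x *v u = spacetime (u $ 1) (qmul x (spatial u))"
  unfolding qrotation_def
  using linear_spacetime_map[OF qmul_linear_right] by (simp add: matrix_works)

lemma smooth_qrotation: "smooth_on UNIV qrotation"
proof -
  have "linear (\<lambda>x. qrotation x - qrotation 0)"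
    unfolding linear_iff matrix_eq matrix_vector_mult_add_rdistrib matrix_vector_mult_diff_rdistrib
      scaleR_matrix_vector_assoc[symmetric] qrotation_apply spacetime_eq_iff spatial_linear
      vector_add_component vector_minus_component vector_scaleR_component
      spacetime_components spatial_spacetime
    by (simp add: linear_add[OF qmul_linear_left] linear_cmul[OF qmul_linear_left]
        linear_0[OF qmul_linear_left])
  then have "smooth_on UNIV (\<lambda>x. (qrotation x - qrotation 0) + qrotation 0)"
    by (intro smooth_on_add smooth_on_linear smooth_on_const open_UNIV)
  then show ?thesis by simp
qed

lemma qrotation_lorentz: "norm x = 1 \<Longrightarrow> lorentz (qrotation x *v u) (qrotation x *v w) = lorentz u w"
  by (simp add: lorentz_def qrotation_apply qmul_inner norm_eq_1)

lemma qrotation_one: "qrotation (axis 1 1) = mat 1"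
  by (simp add: matrix_eq qrotation_apply qmul_one)

lemma det_lorentz_form: "det lorentz_form \<noteq> 0"
proof -
  have "lorentz_form ** lorentz_form = mat 1"
    by (simp add: matrix_eq_inner matrix_vector_mul_assoc[symmetric] lorentz_form_inner)
      (simp add: lorentz_def inner_vec_def sum_5 sum_4 spatial_components matrix_vector_mult_def lorentz_form_def)
  then show ?thesis
    by (metis det_I det_mul mult_zero_left zero_neq_one)
qed

text \<open>
  Preserving the form leaves only the values \<open>1\<close> and \<open>-1\<close>; the sphere is connected and the quaternion
  \<open>1\<close> gives the identity matrix.
\<close>

lemma det_qrotation:
  assumes "norm x = 1"
  shows "det (qrotation x) = 1"
proof (rule ccontr)
  assume "det (qrotation x) \<noteq> 1"
  have sq: "det (qrotation y) ^ 2 = 1" if "norm y = 1" for y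
  proof -
    have "transpose (qrotation y) ** lorentz_form ** qrotation y = lorentz_form"
      using qrotation_lorentz[OF that] by (simp add: preserves_lorentz_form_iff)
    from arg_cong[OF this, of det] show ?thesis
      using det_lorentz_form by (simp add: det_mul det_transpose power2_eq_square)
  qed
  let ?D = "(\<lambda>y. det (qrotation y)) ` sphere 0 1"
  have "smooth_on UNIV (\<lambda>y. det (qrotation y))"
    using smooth_qrotation unfolding smooth_on_def
  proof (intro allI Ck_on_det open_UNIV)
    fix k i j assume "\<forall>k. Ck_on k UNIV qrotation"
    moreover have "bounded_linear (\<lambda>A :: real^5^5. A $ i $ j)"
      by (intro bounded_linear_compose[OF bounded_linear_vec_nth] bounded_linear_vec_nth)
    ultimately show "Ck_on k UNIV (\<lambda>y. qrotation y $ i $ j)"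
      using Ck_on_compose[OF _ Ck_on_bounded_linear, of k UNIV qrotation "\<lambda>A. A $ i $ j" UNIV] by simp
  qed
  then have "continuous_on (sphere 0 1) (\<lambda>y. det (qrotation y))"
    using smooth_on_imp_continuous_on continuous_on_subset by blast
  moreover have "connected (sphere (0 :: real^4) 1)"
    by (rule connected_sphere) simp
  ultimately have "connected ?D"
    by (rule connected_continuous_image)
  moreover have "1 \<in> ?D"
    by (rule image_eqI[of _ _ "axis 1 1"]) (simp_all add: qrotation_one)
  moreover have "- 1 \<in> ?D"
    using sq[OF assms] \<open>det (qrotation x) \<noteq> 1\<close> assms by (intro image_eqI[of _ _ x]) (auto simp: power2_eq_1_iff)
  ultimately have "0 \<in> ?D"
    using connectedD_interval[of ?D "- 1" 1 0] by simp
  then obtain y where "norm y = 1" "det (qrotation y) = 0"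
    by auto
  then show False
    using sq[of y] by simp
qed

lemma qrotation_SO14:
  assumes "norm x = 1"
  shows "qrotation x \<in> SO14"
proof -
  have "qrotation ` sphere 0 1 \<subseteq> SO14"
  proof (rule connected_in_SO14)
    show "connected (qrotation ` sphere 0 1)"
      using smooth_on_imp_continuous_on[OF smooth_qrotation] continuous_on_subset
      by (intro connected_continuous_image connected_sphere) auto
    show "qrotation ` sphere 0 1 \<subseteq> full_SO14"
      by (auto simp: full_SO14_iff det_qrotation qrotation_lorentz)
    have "mat 1 \<in> qrotation ` sphere 0 1"
      by (rule image_eqI[of _ _ "axis 1 1"]) (simp_all add: qrotation_one)
    then show "qrotation ` sphere 0 1 \<inter> SO14 \<noteq> {}"
      using mat_1_SO14 by blast
  qed
  then show ?thesis
    using assms by auto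
qed

section \<open>The action on light rays\<close>

definition stabilizer :: "real^5 \<Rightarrow> (real^5^5) set" where
  "stabilizer n = {g \<in> SO14. \<exists>c. g *v n = c *\<^sub>R n}"

definition ray_image :: "real^4 \<Rightarrow> real^5^5 \<Rightarrow> real^4" where
  "ray_image x g = inverse ((g *v light x) $ 1) *\<^sub>R spatial (g *v light x)"

text \<open>
  An invertible map that preserves the form sends null vectors to nonzero null vectors, and these have
  a nonzero time component.
\<close>

lemma light_ray_image:
  assumes "g \<in> SO14" "norm x = 1"
  shows "(g *v light x) $ 1 \<noteq> 0" "norm (ray_image x g) = 1"
    "g *v light x = (g *v light x) $ 1 *\<^sub>R light (ray_image x g)"
proof -
  let ?u = "g *v light x"
  have "lorentz ?u ?u = lorentz (light x) (light x)"
    using assms by (intro SO14_lorentz)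
  also have "\<dots> = 0"
    using assms by (simp add: lorentz_def norm_eq_1)
  finally have null: "spatial ?u \<bullet> spatial ?u = (?u $ 1)\<^sup>2"
    by (simp add: lorentz_def power2_eq_square)
  show time: "?u $ 1 \<noteq> 0"
  proof
    assume "?u $ 1 = 0"
    then have "?u = 0"
      using null by (simp add: spacetime_eq_iff)
    then have "light x = 0"
      using SO14_cancel(1)[OF assms(1), of "light x"] by simp
    then show False by simp
  qed
  show "norm (ray_image x g) = 1"
    unfolding norm_eq_1 using time null by (simp add: ray_image_def power2_eq_square field_simps)
  show "?u = ?u $ 1 *\<^sub>R light (ray_image x g)"
    using time by (simp add: spacetime_eq_iff ray_image_def)
qed

lemma ray_image_eqI:
  assumes "g *v light x = c *\<^sub>R light y" "c \<noteq> 0"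
  shows "ray_image x g = y"
  by (simp add: ray_image_def assms)

lemma qrotation_light: "qrotation x *v light (axis 1 1) = light x"
  by (simp add: qrotation_apply qmul_one)

lemma stabilizer_light_iff:
  assumes "norm x = 1"
  shows "g \<in> stabilizer (light x) \<longleftrightarrow> g \<in> SO14 \<and> ray_image x g = x"
proof
  assume "g \<in> stabilizer (light x)"
  then obtain c where c: "g \<in> SO14" "g *v light x = c *\<^sub>R light x"
    by (auto simp: stabilizer_def)
  moreover have "c \<noteq> 0"
    using light_ray_image(1)[OF c(1) assms] c(2) by auto
  ultimately show "g \<in> SO14 \<and> ray_image x g = x"
    using ray_image_eqI by blast
next
  assume "g \<in> SO14 \<and> ray_image x g = x"
  then show "g \<in> stabilizer (light x)"
    using light_ray_image(3)[of g x] assms by (auto simp: stabilizer_def)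
qed

lemma stabilizer_scaleR: "c \<noteq> 0 \<Longrightarrow> stabilizer (c *\<^sub>R n) = stabilizer n"
  by (simp add: stabilizer_def matrix_vector_mult_scaleR real_vector.scale_left_commute[of _ c]
      del: scaleR_scaleR)

lemma stabilizer_image:
  assumes h: "h \<in> SO14"
  shows "stabilizer (h *v n) = conjugate h (stabilizer n)"
proof (intro equalityI subsetI)
  fix g assume "g \<in> stabilizer (h *v n)"
  then obtain c where g: "g \<in> SO14" "g *v (h *v n) = c *\<^sub>R (h *v n)"
    by (auto simp: stabilizer_def)
  let ?k = "matrix_inv h ** g ** h"
  have "?k *v n = c *\<^sub>R n"
    using h by (simp add: matrix_vector_mul_assoc[symmetric] g(2) matrix_vector_mult_scaleR)
  moreover have "?k \<in> SO14"
    using g h by (intro SO14_mult SO14_inverse)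
  moreover have "g = h ** ?k ** matrix_inv h"
    using h by (simp add: matrix_mul_assoc[symmetric] SO14_inverse)
  ultimately show "g \<in> conjugate h (stabilizer n)"
    by (auto simp: stabilizer_def conjugate_def)
next
  fix g assume "g \<in> conjugate h (stabilizer n)"
  then obtain k c where k: "k \<in> SO14" "k *v n = c *\<^sub>R n" "g = h ** k ** matrix_inv h"
    by (auto simp: stabilizer_def conjugate_def)
  then have "g *v (h *v n) = c *\<^sub>R (h *v n)"
    using h by (simp add: matrix_vector_mul_assoc[symmetric] matrix_vector_mult_scaleR)
  moreover have "g \<in> SO14"
    using h k by (simp add: SO14_mult SO14_inverse)
  ultimately show "g \<in> stabilizer (h *v n)"
    by (auto simp: stabilizer_def)
qed

lemma left_coset_stabilizer:
  assumes g: "g \<in> SO14" and h: "h \<in> SO14" and x: "norm x = 1"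
  shows "left_coset (stabilizer (light x)) g = left_coset (stabilizer (light x)) h
    \<longleftrightarrow> ray_image x g = ray_image x h"
proof -
  let ?P = "stabilizer (light x)"
  have ray: "ray_image x (a ** p) = ray_image x a" if "a \<in> SO14" "p \<in> ?P" for a p
  proof -
    obtain c where c: "p \<in> SO14" "p *v light x = c *\<^sub>R light x"
      using \<open>p \<in> ?P\<close> by (auto simp: stabilizer_def)
    have "c \<noteq> 0"
      using light_ray_image(1)[OF c(1) x] c(2) by auto
    moreover have "(a ** p) *v light x = (c * (a *v light x) $ 1) *\<^sub>R light (ray_image x a)"
      using arg_cong[OF light_ray_image(3)[OF that(1) x], of "scaleR c"]
      by (simp only: matrix_vector_mul_assoc[symmetric] c(2) matrix_vector_mult_scaleR scaleR_scaleR)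
    ultimately show ?thesis
      using light_ray_image(1)[OF that(1) x] by (simp add: ray_image_eqI[where c = "c * (a *v light x) $ 1"])
  qed
  have coset: "left_coset ?P a = {b \<in> SO14. ray_image x b = ray_image x a}" if a: "a \<in> SO14" for a
  proof (intro equalityI subsetI)
    fix b assume "b \<in> left_coset ?P a"
    then show "b \<in> {b \<in> SO14. ray_image x b = ray_image x a}"
      using a ray by (auto simp: left_coset_def stabilizer_def SO14_mult)
  next
    fix b assume b: "b \<in> {b \<in> SO14. ray_image x b = ray_image x a}"
    let ?s = "(a *v light x) $ 1" and ?t = "(b *v light x) $ 1"
    have "b *v light x = ?t *\<^sub>R light (ray_image x a)"
      using light_ray_image(3)[OF _ x, of b] b by simp
    also have "\<dots> = (?t / ?s) *\<^sub>R (a *v light x)"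
      using light_ray_image(1)[OF a x] by (subst (2) light_ray_image(3)[OF a x]) simp
    finally have "matrix_inv a *v (b *v light x) = matrix_inv a *v ((?t / ?s) *\<^sub>R (a *v light x))"
      by (rule arg_cong)
    then have "(matrix_inv a ** b) *v light x = (?t / ?s) *\<^sub>R light x"
      using a by (simp add: matrix_vector_mul_assoc[symmetric] matrix_vector_mult_scaleR)
    then have "matrix_inv a ** b \<in> ?P"
      using a b unfolding stabilizer_def by (blast intro: SO14_mult SO14_inverse)
    moreover have "b = a ** (matrix_inv a ** b)"
      using a by simp
    ultimately show "b \<in> left_coset ?P a"
      unfolding left_coset_def by blast
  qed
  show ?thesis
    using g h by (auto simp: coset)
qed

text \<open>
  The section through \<open>g\<close> multiplies \<open>g\<close> by the rotation that undoes the quaternion of its own image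
  and then by the rotation of the target point.
\<close>

lemma fibration_ray_image:
  assumes x: "norm x = 1"
  shows "fibration_over_sphere SO14 (stabilizer (light x)) (ray_image x) {g. (g *v light x) $ 1 \<noteq> 0}"
proof
  let ?W = "{g :: real^5^5. (g *v light x) $ 1 \<noteq> 0}"
  have lin: "linear (\<lambda>g :: real^5^5. g *v light x)"
    by (rule linearI) (simp_all add: matrix_vector_mult_add_rdistrib scaleR_matrix_vector_assoc)
  have time: "linear (\<lambda>g :: real^5^5. (g *v light x) $ 1)"
    using linear_compose[OF lin bounded_linear.linear[OF bounded_linear_vec_nth]] by (simp add: o_def)
  have sp: "linear (\<lambda>g :: real^5^5. spatial (g *v light x))"
    using linear_compose[OF lin linear_spatial] by (simp add: o_def)
  show W: "open ?W"
    using smooth_on_open_preimage[OF smooth_on_linear[OF time open_UNIV] open_UNIV, of "- {0}"]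
    by (simp add: open_Compl)
  show "smooth_on ?W (ray_image x)"
    unfolding ray_image_def[abs_def]
    by (intro smooth_on_scaleR smooth_on_inverse smooth_on_linear time sp W) auto
  show "SO14 \<subseteq> ?W"
    using light_ray_image(1)[OF _ x] by auto
  show "SO14 \<noteq> {}"
    using mat_1_SO14 by blast
  show "ray_image x g \<in> sphere 0 1" if "g \<in> SO14" for g
    using light_ray_image(2)[OF that x] by simp
  show "left_coset (stabilizer (light x)) g = left_coset (stabilizer (light x)) h
      \<longleftrightarrow> ray_image x g = ray_image x h" if "g \<in> SO14" "h \<in> SO14" for g h
    using left_coset_stabilizer that x by blast
  fix g assume g: "g \<in> SO14"
  let ?y = "ray_image x g" and ?c = "(g *v light x) $ 1"
  let ?B = "matrix_inv (qrotation ?y) ** g"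
  have y: "qrotation ?y \<in> SO14"
    using light_ray_image(2)[OF g x] by (rule qrotation_SO14)
  have "?B *v light x = ?c *\<^sub>R (matrix_inv (qrotation ?y) *v light ?y)"
    using light_ray_image(3)[OF g x]
    by (metis matrix_vector_mul_assoc matrix_vector_mult_scaleR)
  also have "matrix_inv (qrotation ?y) *v light ?y = light (axis 1 1)"
    using SO14_cancel(1)[OF y, of "light (axis 1 1)"] by (simp add: qrotation_light)
  finally have B: "?B *v light x = ?c *\<^sub>R light (axis 1 1)" .
  let ?\<tau> = "\<lambda>z. qrotation z ** ?B"
  have "linear (\<lambda>A :: real^5^5. A ** ?B)"
    by (rule linearI) (simp_all add: matrix_eq matrix_vector_mult_add_rdistrib
        matrix_vector_mul_assoc[symmetric] scaleR_matrix_vector_assoc[symmetric])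
  then have "smooth_on UNIV ?\<tau>"
    using smooth_on_compose[OF smooth_qrotation smooth_on_linear[OF _ open_UNIV]] by simp
  moreover have "?\<tau> z \<in> SO14 \<and> ray_image x (?\<tau> z) = z" if z: "z \<in> sphere 0 1" for z
  proof
    show "?\<tau> z \<in> SO14"
      using z y g by (simp add: SO14_mult SO14_inverse qrotation_SO14)
    have "?\<tau> z *v light x = ?c *\<^sub>R light z"
      by (simp add: matrix_vector_mul_assoc[symmetric] B[unfolded matrix_vector_mul_assoc[symmetric]]
          matrix_vector_mult_scaleR qrotation_light)
    then show "ray_image x (?\<tau> z) = z"
      using light_ray_image(1)[OF g x] by (rule ray_image_eqI)
  qed
  moreover have "?\<tau> ?y = g"
    using y by simp
  ultimately show "\<exists>\<tau>. smooth_on UNIV \<tau> \<and>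
      (\<forall>z\<in>sphere 0 1. \<tau> z \<in> SO14 \<and> ray_image x (\<tau> z) = z) \<and> \<tau> (ray_image x g) = g"
    by (intro exI[of _ ?\<tau>]) blast
qed

section \<open>Boosts\<close>

definition boost :: "real^4 \<Rightarrow> real^5^5" where
  "boost v = matrix (\<lambda>u. spacetime (v \<bullet> spatial u) (u $ 1 *\<^sub>R v))"

lemma boost_apply: "boost v *v u = spacetime (v \<bullet> spatial u) (u $ 1 *\<^sub>R v)"
proof -
  have "linear (\<lambda>u. spacetime (v \<bullet> spatial u) (u $ 1 *\<^sub>R v))"
    by (rule linearI) (simp_all add: spacetime_eq_iff inner_add_right algebra_simps)
  then show ?thesis
    by (simp add: boost_def matrix_works)
qed

lemma boost_scaleR: "boost (c *\<^sub>R v) = c *\<^sub>R boost v"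
  by (simp add: matrix_eq boost_apply scaleR_matrix_vector_assoc[symmetric] spacetime_eq_iff)

lemma boost_so14: "boost v \<in> so14"
  by (simp add: so14_iff lorentz_def boost_apply inner_commute)

lemma inner_5: "u \<bullet> w = u $ 1 * w $ 1 + spatial u \<bullet> spatial w"
  by (simp add: inner_vec_def sum_5 sum_4 spatial_components)

lemma transpose_eq_iff: "transpose X = X \<longleftrightarrow> (\<forall>u w. (X *v u) \<bullet> w = u \<bullet> (X *v w))"
  for X :: "real^'n^'n"
  unfolding matrix_eq_inner[of "transpose X"]
  by (simp add: dot_lmul_matrix[symmetric] inner_commute)

lemma noncompact_boost: "boost v \<in> cartan_noncompact so14"
  by (simp add: cartan_noncompact_def boost_so14 transpose_eq_iff boost_apply inner_5 inner_commute)

text \<open>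
  A symmetric matrix that is also skew for the Lorentz form pairs time components with spatial
  components only (\<open>mixed\<close>), hence is determined by the image of the time axis.
\<close>

lemma cartan_noncompact_so14:
  assumes "X \<in> cartan_noncompact so14"
  obtains v where "X = boost v"
proof -
  have X: "lorentz (X *v u) w = - lorentz u (X *v w)" "(X *v u) \<bullet> w = u \<bullet> (X *v w)" for u w
    using assms by (auto simp: cartan_noncompact_def so14_iff transpose_eq_iff)
  have mixed: "(X *v u) $ 1 * w $ 1 = spatial u \<bullet> spatial (X *v w)" for u w
    using X[of u w] by (simp add: lorentz_def inner_5)
  define v where "v = spatial (X *v spacetime 1 0)"
  have time: "(X *v u) $ 1 = v \<bullet> spatial u" for u
    using mixed[of u "spacetime 1 0"] by (simp add: v_def inner_commute)
  have spat: "spatial (X *v u) = u $ 1 *\<^sub>R v" for u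
  proof (rule vector_eq_rdot[THEN iffD1], rule allI)
    fix z
    show "spatial (X *v u) \<bullet> z = (u $ 1 *\<^sub>R v) \<bullet> z"
      using mixed[of "spacetime 0 z" u] time[of "spacetime 0 z"] by (simp add: inner_commute mult.commute)
  qed
  have "X *v u = boost v *v u" for u
    by (rule spacetime_eq_iff[THEN iffD2]) (simp add: boost_apply time spat)
  then have "X = boost v"
    by (simp add: matrix_eq)
  then show thesis
    by (rule that)
qed

lemma commuting_boosts:
  assumes "lie_bracket (boost v) (boost w) = 0"
  shows "(v \<bullet> v) *\<^sub>R w = (w \<bullet> v) *\<^sub>R v"
proof -
  have "lie_bracket (boost v) (boost w) *v spacetime 0 v = 0"
    by (simp add: assms)
  then show ?thesis
    by (simp add: lie_bracket_def matrix_vector_mult_diff_rdistrib matrix_vector_mul_assoc[symmetric]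
        boost_apply spacetime_eq_iff)
qed

abbreviation boost_line :: "real^4 \<Rightarrow> (real^5^5) set" where
  "boost_line v \<equiv> range (\<lambda>t. t *\<^sub>R boost v)"

lemma boost_line_mem [simp]: "t *\<^sub>R boost v \<in> boost_line v" "boost v \<in> boost_line v"
  by (auto intro: range_eqI[of _ _ 1])

lemma abelian_boost_line:
  assumes "abelian_in_noncompact so14 a" "boost v \<in> a" "norm v = 1"
  shows "a = boost_line v"
proof (intro equalityI subsetI)
  fix X assume X: "X \<in> a"
  then obtain w where w: "X = boost w"
    using assms(1) cartan_noncompact_so14 unfolding abelian_in_noncompact_def by blast
  have "lie_bracket (boost v) X = 0"
    using assms(1,2) X by (simp add: abelian_in_noncompact_def)
  then have "w = (w \<bullet> v) *\<^sub>R v"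
    using commuting_boosts[of v w] assms(3) by (simp add: w norm_eq_1)
  then have "X = (w \<bullet> v) *\<^sub>R boost v"
    using w boost_scaleR by metis
  then show "X \<in> boost_line v" by blast
next
  fix X assume "X \<in> boost_line v"
  then show "X \<in> a"
    using assms(1,2) by (auto simp: abelian_in_noncompact_def subspace_scale)
qed

lemma maximal_abelian_boost_line:
  assumes "norm v = 1"
  shows "maximal_abelian so14 (boost_line v)" (is "maximal_abelian so14 ?a")
  unfolding maximal_abelian_def
proof (intro conjI allI impI)
  have comm: "t *\<^sub>R boost v = boost (t *\<^sub>R v)" for t
    by (simp add: boost_scaleR)
  have "subspace ?a"
    using span_singleton[of "boost v"] subspace_span by metis
  moreover have "?a \<subseteq> cartan_noncompact so14"
    using noncompact_boost by (auto simp: comm)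
  moreover have "lie_bracket X Y = 0" if "X \<in> ?a" "Y \<in> ?a" for X Y
    using that by (auto simp: lie_bracket_def matrix_scalar_ac scalar_matrix_assoc[symmetric] mult.commute)
  ultimately show abelian: "abelian_in_noncompact so14 ?a"
    by (simp add: abelian_in_noncompact_def)
  fix b assume b: "abelian_in_noncompact so14 b \<and> ?a \<subseteq> b"
  have "boost v \<in> ?a"
    by (rule image_eqI[of _ _ 1]) auto
  then show "b = ?a"
    using b abelian_boost_line[OF _ _ assms] by blast
qed

lemma matrix_vector_mult_minus: "A *v (- u) = - (A *v (u :: real^'n))"
  using matrix_vector_mult_diff_distrib[of A 0 u] by simp

text \<open>
  The eigenspaces of \<open>ad (boost v)\<close>; these are the root spaces for the line spanned by \<open>boost v\<close>.
\<close>

definition boost_eigenspace :: "real^4 \<Rightarrow> real \<Rightarrow> (real^5^5) set" where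
  "boost_eigenspace v c = {X \<in> so14. lie_bracket (boost v) X = c *\<^sub>R X}"

definition ray_stabilizer_algebra :: "real^5 \<Rightarrow> (real^5^5) set" where
  "ray_stabilizer_algebra n = {X \<in> so14. \<exists>c. X *v n = c *\<^sub>R n}"

lemma lie_bracket_apply: "lie_bracket X Y *v u = X *v (Y *v u) - Y *v (X *v u)"
  by (simp add: lie_bracket_def matrix_vector_mult_diff_rdistrib matrix_vector_mul_assoc[symmetric])

lemma boost_light:
  assumes "norm v = 1"
  shows "boost v *v light v = light v" "boost v *v light (- v) = - light (- v)"
  using assms by (simp_all add: boost_apply spacetime_eq_iff norm_eq_1)

lemma boost_orthogonal: "v \<bullet> w = 0 \<Longrightarrow> boost v *v spacetime 0 w = 0"
  by (simp add: boost_apply)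

text \<open>
  On the plane spanned by \<open>light v\<close> and \<open>light (- v)\<close> the square of \<open>boost v\<close> is the identity, and its
  range lies in that plane.
\<close>

lemma boost_eigenvector:
  assumes "norm v = 1" "boost v *v z = c *\<^sub>R z" "c \<noteq> 0"
  shows "z = z $ 1 *\<^sub>R spacetime 1 (c *\<^sub>R v)" and "c\<^sup>2 \<noteq> 1 \<Longrightarrow> z = 0"
proof -
  have 1: "v \<bullet> spatial z = c * z $ 1" "z $ 1 *\<^sub>R v = c *\<^sub>R spatial z"
    using assms(2) by (auto simp: boost_apply spacetime_eq_iff)
  have "c * (v \<bullet> spatial z) = v \<bullet> (z $ 1 *\<^sub>R v)"
    by (simp add: 1(2))
  then have 2: "c\<^sup>2 * z $ 1 = z $ 1"
    using assms(1) by (simp add: 1(1) norm_eq_1 power2_eq_square)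
  have "c *\<^sub>R spatial z = c *\<^sub>R (z $ 1 * c) *\<^sub>R v"
    using 2 by (simp add: 1(2)[symmetric] power2_eq_square mult_ac)
  then have "spatial z = (z $ 1 * c) *\<^sub>R v"
    using assms(3) by (simp only: scaleR_cancel_left) simp
  then show "z = z $ 1 *\<^sub>R spacetime 1 (c *\<^sub>R v)"
    by (simp add: spacetime_eq_iff)
  show "z = 0" if "c\<^sup>2 \<noteq> 1"
  proof -
    have "z $ 1 = 0"
      using 2 that by simp
    then show ?thesis
      using 1(2) assms(3) by (simp add: spacetime_eq_iff)
  qed
qed

text \<open>
  Because \<open>light v\<close> and \<open>light (- v)\<close> are null vectors with product \<open>2\<close>, each coefficient is read
  off by pairing with the opposite vector.
\<close>

lemma light_basis:
  assumes "norm v = 1"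
  obtains a b w where "u = a *\<^sub>R light v + b *\<^sub>R light (- v) + spacetime 0 w" "v \<bullet> w = 0"
    "lorentz u (light (- v)) = 2 * a" "lorentz u (light v) = 2 * b"
proof -
  let ?a = "lorentz u (light (- v)) / 2" and ?b = "lorentz u (light v) / 2"
  let ?w = "spatial u - (v \<bullet> spatial u) *\<^sub>R v"
  have ab: "?a = (u $ 1 + v \<bullet> spatial u) / 2" "?b = (u $ 1 - v \<bullet> spatial u) / 2"
    by (simp_all add: lorentz_def inner_commute)
  have "u = ?a *\<^sub>R light v + ?b *\<^sub>R light (- v) + spacetime 0 ?w"
    unfolding ab
    by (simp add: spacetime_eq_iff scaleR_diff_left[symmetric] add_divide_distrib diff_divide_distrib)
  moreover have "v \<bullet> ?w = 0"
    using assms by (simp add: inner_diff_right norm_eq_1)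
  ultimately show ?thesis
    by (rule that) simp_all
qed

lemma light_basis_eqI:
  assumes "norm v = 1" "A *v light v = B *v light v" "A *v light (- v) = B *v light (- v)"
    and "\<And>w. v \<bullet> w = 0 \<Longrightarrow> A *v spacetime 0 w = B *v spacetime 0 w"
  shows "A = (B :: real^5^5)"
  unfolding matrix_eq
proof
  fix u
  obtain a b w where "u = a *\<^sub>R light v + b *\<^sub>R light (- v) + spacetime 0 w" "v \<bullet> w = 0"
    using light_basis[OF assms(1)] by metis
  then show "A *v u = B *v u"
    using assms by (simp add: matrix_vector_right_distrib matrix_vector_mult_scaleR)
qed

lemma lorentz_light:
  assumes "norm v = 1"
  shows "lorentz (light v) (light v) = 0" "lorentz (light (- v)) (light (- v)) = 0"
    "lorentz (light v) (light (- v)) = 2" "lorentz (light (- v)) (light v) = 2"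
    "v \<bullet> w = 0 \<Longrightarrow> lorentz (spacetime 0 w) (light v) = 0"
  using assms by (simp_all add: lorentz_def norm_eq_1 inner_commute)

lemma so14_skew: "X \<in> so14 \<Longrightarrow> lorentz (X *v u) w = - lorentz u (X *v w)"
  by (simp add: so14_iff)

lemma so14_isotropic: "X \<in> so14 \<Longrightarrow> lorentz (X *v u) u = 0"
  using so14_skew[of X u u] by (simp add: lorentz_commute)

lemma eigenspace_shift:
  assumes "X \<in> boost_eigenspace v c" "boost v *v u = d *\<^sub>R u"
  shows "boost v *v (X *v u) = (c + d) *\<^sub>R (X *v u)"
proof -
  have "boost v *v (X *v u) - X *v (boost v *v u) = c *\<^sub>R (X *v u)"
    using assms(1) lie_bracket_apply[of "boost v" X u]
    by (simp add: boost_eigenspace_def scaleR_matrix_vector_assoc)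
  then show ?thesis
    by (simp add: assms(2) matrix_vector_mult_scaleR scaleR_add_left algebra_simps)
qed

text \<open>
  A shift of the eigenvalues \<open>1, 0, -1\<close> by \<open>c\<close> leads outside of the spectrum, except that \<open>c = 2\<close>
  could send \<open>light (- v)\<close> to a multiple of \<open>light v\<close>.  This multiple is zero because \<open>X\<close> is skew:
  \<open>X u\<close> is Lorentz orthogonal to \<open>u\<close>, whereas the two null vectors are not orthogonal.
\<close>

lemma boost_eigenvalue:
  assumes v: "norm v = 1" and X: "X \<in> boost_eigenspace v c" and c: "0 < c" "c \<noteq> 1"
  shows "X = 0"
proof (rule light_basis_eqI[OF v])
  have H: "boost v *v light v = 1 *\<^sub>R light v" "boost v *v light (- v) = (- 1) *\<^sub>R light (- v)"
    using boost_light[OF v] by simp_all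
  show "X *v light v = 0 *v light v"
    using boost_eigenvector(2)[OF v eigenspace_shift[OF X H(1)]] c by (simp add: power2_eq_1_iff)
  show "X *v spacetime 0 w = 0 *v spacetime 0 w" if "v \<bullet> w = 0" for w
    using boost_eigenvector(2)[OF v eigenspace_shift[OF X, of "spacetime 0 w" 0]] boost_orthogonal[OF that] c
    by (simp add: power2_eq_1_iff)
  let ?z = "X *v light (- v)"
  have z: "boost v *v ?z = (c - 1) *\<^sub>R ?z"
    using eigenspace_shift[OF X H(2)] by simp
  show "?z = 0 *v light (- v)"
  proof (cases "c = 2")
    case True
    then have "?z = ?z $ 1 *\<^sub>R light v"
      using boost_eigenvector(1)[OF v z] by simp
    moreover have "lorentz ?z (light (- v)) = 0"
      using X by (simp add: boost_eigenspace_def so14_isotropic)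
    ultimately have "?z $ 1 = 0"
      using lorentz_linear(5)[of "?z $ 1" "light v" "light (- v)"] lorentz_light(3)[OF v] by simp
    then show ?thesis
      using \<open>?z = ?z $ 1 *\<^sub>R light v\<close> by simp
  next
    case False
    then show ?thesis
      using boost_eigenvector(2)[OF v z] c by (simp add: power2_eq_1_iff)
  qed
qed

lemma subspace_ray_stabilizer_algebra: "subspace (ray_stabilizer_algebra n)"
  unfolding subspace_def
proof (intro conjI ballI allI)
  show "0 \<in> ray_stabilizer_algebra n"
    by (auto simp: ray_stabilizer_algebra_def so14_iff lorentz_def intro: exI[of _ 0])
  fix X Y assume "X \<in> ray_stabilizer_algebra n" "Y \<in> ray_stabilizer_algebra n"
  then obtain b c where "X \<in> so14" "Y \<in> so14" "X *v n = b *\<^sub>R n" "Y *v n = c *\<^sub>R n"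
    by (auto simp: ray_stabilizer_algebra_def)
  then show "X + Y \<in> ray_stabilizer_algebra n"
    by (auto simp: ray_stabilizer_algebra_def so14_iff matrix_vector_mult_add_rdistrib lorentz_linear
        intro: exI[of _ "b + c"] simp: scaleR_add_left)
next
  fix r X assume "X \<in> ray_stabilizer_algebra n"
  then obtain c where "X \<in> so14" "X *v n = c *\<^sub>R n"
    by (auto simp: ray_stabilizer_algebra_def)
  then show "r *\<^sub>R X \<in> ray_stabilizer_algebra n"
    by (auto simp: ray_stabilizer_algebra_def so14_iff scaleR_matrix_vector_assoc[symmetric] lorentz_linear
        intro: exI[of _ "r * c"])
qed

lemma lie_bracket_so14: "X \<in> so14 \<Longrightarrow> Y \<in> so14 \<Longrightarrow> lie_bracket X Y \<in> so14"
  by (simp add: so14_iff lie_bracket_apply lorentz_linear)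

text \<open>
  Eigenvalue shifts show that the two eigenspaces preserve the ray.  Conversely, let \<open>X\<close> preserve it.
  Skewness makes \<open>X\<close> block triangular in the light basis: the image of \<open>light (- v)\<close> has no component
  along \<open>light v\<close>, and the image of a vector orthogonal to both has none along \<open>light (- v)\<close>.
  Hence \<open>Y = [boost v, X]\<close> satisfies \<open>[boost v, Y] = Y\<close>, and \<open>X = (X - Y) + Y\<close> is the decomposition
  into eigenvectors for \<open>0\<close> and \<open>1\<close>.
\<close>

lemma span_boost_eigenspaces:
  assumes v: "norm v = 1"
  shows "span (boost_eigenspace v 0 \<union> boost_eigenspace v 1) = ray_stabilizer_algebra (light v)"
proof
  show "span (boost_eigenspace v 0 \<union> boost_eigenspace v 1) \<subseteq> ray_stabilizer_algebra (light v)"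
  proof (rule span_minimal[OF _ subspace_ray_stabilizer_algebra], safe)
    have H: "boost v *v light v = 1 *\<^sub>R light v"
      using boost_light[OF v] by simp
    fix X
    {
      assume X: "X \<in> boost_eigenspace v 0"
      show "X \<in> ray_stabilizer_algebra (light v)"
        using boost_eigenvector(1)[OF v eigenspace_shift[OF X H]] X
        by (auto simp: ray_stabilizer_algebra_def boost_eigenspace_def)
    next
      assume X: "X \<in> boost_eigenspace v 1"
      show "X \<in> ray_stabilizer_algebra (light v)"
        using boost_eigenvector(2)[OF v eigenspace_shift[OF X H]] X
        by (auto simp: ray_stabilizer_algebra_def boost_eigenspace_def intro: exI[of _ 0])
    }
  qed
next
  show "ray_stabilizer_algebra (light v) \<subseteq> span (boost_eigenspace v 0 \<union> boost_eigenspace v 1)"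
  proof
    fix X assume "X \<in> ray_stabilizer_algebra (light v)"
    then obtain c where X: "X \<in> so14" "X *v light v = c *\<^sub>R light v"
      by (auto simp: ray_stabilizer_algebra_def)
    let ?H = "boost v"
    let ?Y = "lie_bracket ?H X"
    have Y: "?Y \<in> so14"
      by (simp add: lie_bracket_so14 boost_so14 X)
    have "lie_bracket ?H ?Y = ?Y"
    proof (rule light_basis_eqI[OF v])
      show "lie_bracket ?H ?Y *v light v = ?Y *v light v"
        by (simp add: lie_bracket_apply X boost_light[OF v] matrix_vector_mult_scaleR)
      show "lie_bracket ?H ?Y *v light (- v) = ?Y *v light (- v)"
      proof -
        obtain a b w where w: "X *v light (- v) = a *\<^sub>R light v + b *\<^sub>R light (- v) + spacetime 0 w"
            "v \<bullet> w = 0" "lorentz (X *v light (- v)) (light (- v)) = 2 * a"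
            "lorentz (X *v light (- v)) (light v) = 2 * b"
          using light_basis[OF v] by metis
        have "a = 0"
          using w(3) so14_isotropic[OF X(1)] by simp
        have "?Y *v light (- v) = spacetime 0 w"
          by (simp add: lie_bracket_apply w(1) \<open>a = 0\<close> boost_light[OF v] boost_orthogonal[OF w(2)]
              matrix_vector_right_distrib matrix_vector_mult_scaleR matrix_vector_mult_minus)
        then show ?thesis
          by (subst lie_bracket_apply)
            (simp add: boost_light[OF v] boost_orthogonal[OF w(2)] matrix_vector_mult_minus)
      qed
      show "lie_bracket ?H ?Y *v spacetime 0 z = ?Y *v spacetime 0 z" if z: "v \<bullet> z = 0" for z
      proof -
        obtain a b w where w: "X *v spacetime 0 z = a *\<^sub>R light v + b *\<^sub>R light (- v) + spacetime 0 w"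
            "v \<bullet> w = 0" "lorentz (X *v spacetime 0 z) (light v) = 2 * b"
          using light_basis[OF v] by metis
        have "b = 0"
          using w(3) so14_skew[OF X(1), of "spacetime 0 z" "light v"] lorentz_light(5)[OF v z]
          by (simp add: X(2) lorentz_linear)
        have "?Y *v spacetime 0 z = a *\<^sub>R light v"
          by (simp add: lie_bracket_apply w(1) \<open>b = 0\<close> boost_light[OF v] boost_orthogonal[OF w(2)]
              boost_orthogonal[OF z] matrix_vector_right_distrib matrix_vector_mult_scaleR)
        then show ?thesis
          by (subst lie_bracket_apply)
            (simp add: boost_light[OF v] boost_orthogonal[OF z] matrix_vector_mult_scaleR)
      qed
    qed
    then have "?Y \<in> boost_eigenspace v 1"
      using Y by (simp add: boost_eigenspace_def)
    moreover have "lie_bracket ?H (X - ?Y) = lie_bracket ?H X - lie_bracket ?H ?Y"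
      by (simp add: matrix_eq matrix_vector_mult_diff_rdistrib lie_bracket_apply matrix_vector_mult_diff_distrib)
    then have "X - ?Y \<in> boost_eigenspace v 0"
      using X Y \<open>lie_bracket ?H ?Y = ?Y\<close>
      by (simp add: boost_eigenspace_def so14_iff matrix_vector_mult_diff_rdistrib lorentz_linear)
    ultimately have "(X - ?Y) + ?Y \<in> span (boost_eigenspace v 0 \<union> boost_eigenspace v 1)"
      by (intro span_add span_base) auto
    then show "X \<in> span (boost_eigenspace v 0 \<union> boost_eigenspace v 1)" by simp
  qed
qed

text \<open>
  The wedge product of \<open>light v\<close> and a spatial vector \<open>w\<close>, as a skew map for the Lorentz form.
\<close>

definition null_rotation :: "real^4 \<Rightarrow> real^4 \<Rightarrow> real^5^5" where
  "null_rotation v w = matrix (\<lambda>u. lorentz (light v) u *\<^sub>R spacetime 0 w - lorentz (spacetime 0 w) u *\<^sub>R light v)"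

lemma null_rotation_apply:
  "null_rotation v w *v u = lorentz (light v) u *\<^sub>R spacetime 0 w - lorentz (spacetime 0 w) u *\<^sub>R light v"
proof -
  have "linear (\<lambda>u. lorentz (light v) u *\<^sub>R spacetime 0 w - lorentz (spacetime 0 w) u *\<^sub>R light v)"
    by (rule linearI) (simp_all add: lorentz_linear algebra_simps)
  then show ?thesis
    by (simp add: null_rotation_def matrix_works)
qed

lemma null_rotation_eigenspace:
  assumes "norm v = 1" "v \<bullet> w = 0"
  shows "null_rotation v w \<in> boost_eigenspace v 1"
proof -
  have "null_rotation v w \<in> so14"
    by (simp add: so14_iff null_rotation_apply lorentz_linear lorentz_commute)
  moreover have "lie_bracket (boost v) (null_rotation v w) *v u = null_rotation v w *v u" for u
  proof -
    have "lorentz (light v) (boost v *v u) = - lorentz (light v) u"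
      using so14_skew[OF boost_so14, of v "light v" u] boost_light(1)[OF assms(1)] by simp
    moreover have "lorentz (spacetime 0 w) (boost v *v u) = 0"
      using so14_skew[OF boost_so14, of v "spacetime 0 w" u] boost_orthogonal[OF assms(2)]
      by (simp add: lorentz_def)
    ultimately show ?thesis
      by (simp add: lie_bracket_apply null_rotation_apply matrix_vector_mult_diff_distrib
          matrix_vector_mult_scaleR boost_light[OF assms(1)] boost_orthogonal[OF assms(2)])
  qed
  ultimately show ?thesis
    by (simp add: boost_eigenspace_def matrix_eq)
qed

text \<open>
  Left multiplication by the quaternion \<open>i\<close>, which is \<open>axis 2 1\<close>, turns every vector into an orthogonal one.
\<close>

lemma orthogonal_unit_exists:
  obtains w :: "real^4" where "v \<bullet> w = 0" "norm v = 1 \<Longrightarrow> norm w = 1"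
proof (rule that[of "qmul (axis 2 1) v"])
  show "v \<bullet> qmul (axis 2 1) v = 0"
    by (simp add: inner_vec_4 qmul_components axis_def)
  show "norm (qmul (axis 2 1) v) = 1" if "norm v = 1"
    using that by (simp add: norm_eq_1 qmul_inner) 
qed

text \<open>
  Since \<open>boost v\<close> is in the algebra, the only rays that can be preserved are those of \<open>v\<close> and \<open>- v\<close>;
  a null rotation about the first ray moves the second.
\<close>

lemma ray_stabilizer_algebra_inj:
  assumes v: "norm v = 1" and y: "norm y = 1"
    and eq: "ray_stabilizer_algebra (light y) = ray_stabilizer_algebra (light v)"
  shows "y = v"
proof -
  have "boost v \<in> ray_stabilizer_algebra (light v)"
    using boost_so14 boost_light[OF v] by (auto simp: ray_stabilizer_algebra_def intro: exI[of _ 1])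
  then have "boost v \<in> ray_stabilizer_algebra (light y)"
    by (simp only: eq)
  then obtain c where "boost v *v light y = c *\<^sub>R light y"
    by (auto simp: ray_stabilizer_algebra_def)
  then have c: "v = c *\<^sub>R y"
    by (auto simp: boost_apply spacetime_eq_iff)
  have "\<bar>c\<bar> = 1"
    using v y by (simp add: c)
  moreover have "c \<noteq> - 1"
  proof
    assume "c = - 1"
    then have y: "y = - v"
      by (simp add: c)
    obtain w where w: "v \<bullet> w = 0" "norm w = 1"
      using orthogonal_unit_exists v by metis
    have "null_rotation v w \<in> ray_stabilizer_algebra (light v)"
      unfolding span_boost_eigenspaces[OF v, symmetric]
      by (intro span_base UnI2 null_rotation_eigenspace v w(1))
    then have "null_rotation v w \<in> ray_stabilizer_algebra (light (- v))"
      using eq by (simp only: y)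
    then obtain d where "null_rotation v w *v light (- v) = d *\<^sub>R light (- v)"
      by (auto simp: ray_stabilizer_algebra_def)
    moreover have "null_rotation v w *v light (- v) = 2 *\<^sub>R spacetime 0 w"
      using w(1) by (simp add: null_rotation_apply lorentz_light[OF v] lorentz_def[of "spacetime 0 w"] inner_commute)
    ultimately have "2 *\<^sub>R spacetime 0 w = d *\<^sub>R light (- v)"
      by simp
    then have "d = 0 \<and> 2 *\<^sub>R w = - d *\<^sub>R v"
      by (simp add: spacetime_eq_iff)
    then show False
      using w(2) by auto
  qed
  ultimately have "c = 1"
    by linarith
  then show ?thesis
    using c by simp
qed

lemma conjugate_ray_stabilizer_algebra:
  assumes g: "g \<in> SO14"
  shows "conjugate g (ray_stabilizer_algebra n) = ray_stabilizer_algebra (g *v n)"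
proof -
  have incl: "h ** X ** matrix_inv h \<in> ray_stabilizer_algebra (h *v m)"
    if h: "h \<in> SO14" and X: "X \<in> ray_stabilizer_algebra m" for h X m
  proof -
    have "lorentz (h *v (X *v (matrix_inv h *v u))) w = - lorentz u (h *v (X *v (matrix_inv h *v w)))" for u w
    proof -
      have "lorentz (h *v (X *v (matrix_inv h *v u))) (h *v (matrix_inv h *v w))
          = - lorentz (h *v (matrix_inv h *v u)) (h *v (X *v (matrix_inv h *v w)))"
        using X so14_skew unfolding SO14_lorentz[OF h] ray_stabilizer_algebra_def by blast
      then show ?thesis
        using h by simp
    qed
    moreover obtain c where "X *v m = c *\<^sub>R m"
      using X by (auto simp: ray_stabilizer_algebra_def)
    ultimately show ?thesis
      using h by (auto simp: ray_stabilizer_algebra_def so14_iff matrix_vector_mul_assoc[symmetric]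
          matrix_vector_mult_scaleR intro: exI[of _ c])
  qed
  show ?thesis
  proof
    show "conjugate g (ray_stabilizer_algebra n) \<subseteq> ray_stabilizer_algebra (g *v n)"
      using incl[OF g] by (auto simp: conjugate_def)
    show "ray_stabilizer_algebra (g *v n) \<subseteq> conjugate g (ray_stabilizer_algebra n)"
    proof
      fix Y assume Y: "Y \<in> ray_stabilizer_algebra (g *v n)"
      have inv: "matrix_inv (matrix_inv g) = g"
        using SO14_inverse[OF g] by (intro matrix_inv_unique)
      have "matrix_inv g ** Y ** g \<in> ray_stabilizer_algebra n"
        using incl[OF SO14_inverse(3)[OF g] Y] g by (simp add: inv)
      moreover have "Y = g ** (matrix_inv g ** Y ** g) ** matrix_inv g"
        using g by (simp add: matrix_mul_assoc[symmetric] SO14_inverse)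
      ultimately show "Y \<in> conjugate g (ray_stabilizer_algebra n)"
        unfolding conjugate_def by blast
    qed
  qed
qed

lemma normalizer_ray_stabilizer_algebra:
  assumes v: "norm v = 1"
  shows "{g \<in> SO14. conjugate g (ray_stabilizer_algebra (light v)) = ray_stabilizer_algebra (light v)}
    = stabilizer (light v)"
proof -
  have "conjugate g (ray_stabilizer_algebra (light v)) = ray_stabilizer_algebra (light v)
      \<longleftrightarrow> ray_image v g = v" if g: "g \<in> SO14" for g
  proof -
    have scale: "ray_stabilizer_algebra (c *\<^sub>R n) = ray_stabilizer_algebra n" if "c \<noteq> 0" for c n
      using that
      by (simp add: ray_stabilizer_algebra_def matrix_vector_mult_scaleR
          real_vector.scale_left_commute[of _ c] del: scaleR_scaleR)
    have "conjugate g (ray_stabilizer_algebra (light v))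
        = ray_stabilizer_algebra ((g *v light v) $ 1 *\<^sub>R light (ray_image v g))"
      using conjugate_ray_stabilizer_algebra[OF g] light_ray_image(3)[OF g v] by simp
    also have "\<dots> = ray_stabilizer_algebra (light (ray_image v g))"
      using light_ray_image(1)[OF g v] by (rule scale)
    finally have conj: "conjugate g (ray_stabilizer_algebra (light v))
        = ray_stabilizer_algebra (light (ray_image v g))" .
    have "ray_stabilizer_algebra (light (ray_image v g)) = ray_stabilizer_algebra (light v)
        \<longleftrightarrow> ray_image v g = v"
      by (rule iffI) (erule ray_stabilizer_algebra_inj[OF v light_ray_image(2)[OF g v]], simp)
    then show ?thesis
      by (simp only: conj)
  qed
  then show ?thesis
    by (intro set_eqI) (simp add: stabilizer_light_iff v cong: conj_cong)
qed

section \<open>Parabolic subgroups are stabilizers of light rays\<close>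

text \<open>
  The linear functional with value \<open>1\<close> at \<open>boost v\<close>, in the representation used for restricted roots.
\<close>

definition boost_root :: "real^4 \<Rightarrow> real^5^5 \<Rightarrow> real" where
  "boost_root v = restrict (\<lambda>X. (X *v spacetime 1 0) \<bullet> spacetime 0 v) (boost_line v)"

context
  fixes v :: "real^4"
  assumes v: "norm v = 1"
begin

lemma boost_root_scaleR: "boost_root v (t *\<^sub>R boost v) = t"
  using v by (simp add: boost_root_def scaleR_matrix_vector_assoc[symmetric] boost_apply inner_5 norm_eq_1)

lemma root_space_boost_line:
  assumes "\<And>t. \<alpha> (t *\<^sub>R boost v) = t * c"
  shows "root_space so14 (boost_line v) \<alpha> = boost_eigenspace v c"
proof -
  have "lie_bracket (t *\<^sub>R boost v) X = t *\<^sub>R lie_bracket (boost v) X" for t X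
    by (simp add: matrix_eq lie_bracket_apply scaleR_matrix_vector_assoc[symmetric]
        matrix_vector_mult_scaleR scaleR_diff_right)
  then have "(\<forall>t. lie_bracket (t *\<^sub>R boost v) X = \<alpha> (t *\<^sub>R boost v) *\<^sub>R X)
      \<longleftrightarrow> lie_bracket (boost v) X = c *\<^sub>R X" for X
    by (auto simp: assms dest: spec[of _ 1])
  then show ?thesis
    by (auto simp: root_space_def boost_eigenspace_def)
qed

lemma boost_eigenspace_1_nonzero: "boost_eigenspace v 1 \<noteq> {0}"
proof -
  obtain w where w: "v \<bullet> w = 0" "norm w = 1"
    using orthogonal_unit_exists v by metis
  have "null_rotation v w *v light (- v) = 2 *\<^sub>R spacetime 0 w"
    using w(1) by (simp add: null_rotation_apply lorentz_light[OF v] lorentz_def[of "spacetime 0 w"] inner_commute)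
  moreover have "2 *\<^sub>R spacetime 0 w \<noteq> 0"
    using w(2) by auto
  ultimately have "null_rotation v w \<noteq> 0"
    by (metis matrix_vector_mult_0)
  then show ?thesis
    using null_rotation_eigenspace[OF v w(1)] by blast
qed

lemma positive_roots_boost_line:
  assumes "c > 0"
  shows "positive_roots so14 (boost_line v) (c *\<^sub>R boost v) = {boost_root v}"
proof (intro equalityI subsetI)
  fix \<alpha> assume \<alpha>: "\<alpha> \<in> positive_roots so14 (boost_line v) (c *\<^sub>R boost v)"
  then obtain f where f: "linear f" "\<alpha> = restrict f (boost_line v)"
    by (auto simp: positive_roots_def restricted_roots_def)
  define d where "d = f (boost v)"
  have val: "\<alpha> (t *\<^sub>R boost v) = t * d" for t
    using linear_cmul[OF f(1)] by (simp add: f(2) d_def)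
  have "d > 0"
    using \<alpha> assms by (simp add: positive_roots_def val zero_less_mult_iff)
  have "boost_eigenspace v d \<noteq> {0}"
    using \<alpha> root_space_boost_line[OF val] by (simp add: positive_roots_def restricted_roots_def)
  moreover have "0 \<in> boost_eigenspace v d"
    by (simp add: boost_eigenspace_def so14_iff lorentz_def lie_bracket_def)
  ultimately have "d = 1"
    using boost_eigenvalue[OF v _ \<open>d > 0\<close>] by blast
  have "\<alpha> X = boost_root v X" for X
  proof (cases "X \<in> boost_line v")
    case True
    then show ?thesis
      using val boost_root_scaleR \<open>d = 1\<close> by auto
  next
    case False
    then show ?thesis
      by (simp add: f(2) boost_root_def)
  qed
  then show "\<alpha> \<in> {boost_root v}" by auto
next
  fix \<alpha> assume "\<alpha> \<in> {boost_root v}"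
  then have \<alpha>: "\<alpha> = boost_root v" by simp
  have "linear (\<lambda>X :: real^5^5. (X *v spacetime 1 0) \<bullet> spacetime 0 v)"
    by (rule linearI) (simp_all add: matrix_vector_mult_add_rdistrib inner_add_left
        scaleR_matrix_vector_assoc[symmetric])
  moreover have "root_space so14 (boost_line v) (boost_root v) = boost_eigenspace v 1"
    by (rule root_space_boost_line) (simp add: boost_root_scaleR)
  moreover have "\<exists>H\<in>boost_line v. boost_root v H \<noteq> 0"
    by (intro bexI[of _ "1 *\<^sub>R boost v"]) (simp_all only: boost_root_scaleR, auto)
  ultimately have "boost_root v \<in> restricted_roots so14 (boost_line v)"
    unfolding restricted_roots_def using boost_eigenspace_1_nonzero boost_root_def by blast
  then show "\<alpha> \<in> positive_roots so14 (boost_line v) (c *\<^sub>R boost v)"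
    using assms by (simp add: positive_roots_def \<alpha> boost_root_scaleR)
qed

lemma simple_roots_boost_line:
  assumes "c > 0"
  shows "simple_roots so14 (boost_line v) (c *\<^sub>R boost v) = {boost_root v}"
proof -
  have "\<not> (\<forall>H\<in>boost_line v. boost_root v H = boost_root v H + boost_root v H)"
  proof
    assume "\<forall>H\<in>boost_line v. boost_root v H = boost_root v H + boost_root v H"
    then have "boost_root v (1 *\<^sub>R boost v) = boost_root v (1 *\<^sub>R boost v) + boost_root v (1 *\<^sub>R boost v)"
      by blast
    then show False
      unfolding boost_root_scaleR by simp
  qed
  then show ?thesis
    by (auto simp: simple_roots_def positive_roots_boost_line[OF assms])
qed

lemma minimal_parabolic_subalgebra:
  assumes "c > 0"
  shows "parabolic_subalgebra so14 (boost_line v) (c *\<^sub>R boost v) {} = ray_stabilizer_algebra (light v)"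
proof -
  have "generated_positive_roots so14 (boost_line v) (c *\<^sub>R boost v) {} = {}"
    by (auto simp: generated_positive_roots_def positive_roots_boost_line[OF assms] boost_root_scaleR
        intro: exI[of _ 1])
  moreover have "root_space so14 (boost_line v) (\<lambda>_. 0) = boost_eigenspace v 0"
    by (rule root_space_boost_line) simp
  moreover have "root_space so14 (boost_line v) (boost_root v) = boost_eigenspace v 1"
    by (rule root_space_boost_line) (simp add: boost_root_scaleR)
  ultimately show ?thesis
    by (simp add: parabolic_subalgebra_def positive_roots_boost_line[OF assms] span_boost_eigenspaces[OF v])
qed

lemma minimal_parabolic_subgroup:
  assumes "c > 0"
  shows "parabolic_subgroup SO14 so14 (boost_line v) (c *\<^sub>R boost v) {} = stabilizer (light v)"
  by (simp only: parabolic_subgroup_def minimal_parabolic_subalgebra[OF assms]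
      normalizer_ray_stabilizer_algebra[OF v])

end

text \<open>
  A regular element \<open>H0\<close> is a boost, and it is nonzero because a proper subset of the simple roots
  exists only if there is a root.  Its direction \<open>v\<close> spans the maximal abelian subspace, and the
  chamber is the one on which the root of \<open>boost v\<close> is positive.
\<close>

lemma proper_parabolic_iff:
  "is_proper_parabolic SO14 so14 P \<longleftrightarrow> (\<exists>x. norm x = 1 \<and> P = stabilizer (light x))"
proof
  assume "is_proper_parabolic SO14 so14 P"
  then obtain a H0 \<Theta> g where a: "maximal_abelian so14 a" and H0: "regular_element so14 a H0"
      and \<Theta>: "\<Theta> \<subset> simple_roots so14 a H0" and g: "g \<in> SO14"
      and P: "P = conjugate g (parabolic_subgroup SO14 so14 a H0 \<Theta>)"
    unfolding is_proper_parabolic_def by blast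
  have abelian: "abelian_in_noncompact so14 a" and "H0 \<in> a"
    using a H0 by (auto simp: maximal_abelian_def regular_element_def)
  then obtain u where u: "H0 = boost u"
    using cartan_noncompact_so14 unfolding abelian_in_noncompact_def by blast
  have "H0 \<noteq> 0"
  proof
    assume "H0 = 0"
    obtain \<alpha> where "\<alpha> \<in> simple_roots so14 a H0"
      using \<Theta> by blast
    then have \<alpha>: "\<alpha> \<in> restricted_roots so14 a" "0 < \<alpha> H0"
      by (simp_all add: simple_roots_def positive_roots_def)
    then obtain f where f: "linear f" "\<alpha> = restrict f a"
      by (auto simp: restricted_roots_def)
    then show False
      using \<alpha>(2) \<open>H0 \<in> a\<close> linear_0[OF f(1)] by (simp add: \<open>H0 = 0\<close>)
  qed
  then have "u \<noteq> 0"
    using boost_scaleR[of 0 u] by (auto simp: u)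
  define v where "v = inverse (norm u) *\<^sub>R u"
  have v: "norm v = 1" and c: "norm u > 0" and H0_v: "H0 = norm u *\<^sub>R boost v"
    using \<open>u \<noteq> 0\<close> by (simp_all add: v_def boost_scaleR u)
  have "inverse (norm u) *\<^sub>R H0 \<in> a"
    using abelian \<open>H0 \<in> a\<close> by (simp add: abelian_in_noncompact_def subspace_scale)
  then have "boost v \<in> a"
    using c by (simp add: H0_v)
  then have a_v: "a = boost_line v"
    by (rule abelian_boost_line[OF abelian _ v])
  have "\<Theta> = {}"
    using \<Theta> by (auto simp: a_v H0_v simple_roots_boost_line[OF v c])
  then have "P = conjugate g (stabilizer (light v))"
    by (simp add: P a_v H0_v minimal_parabolic_subgroup[OF v c])
  also have "\<dots> = stabilizer (g *v light v)"
    by (rule stabilizer_image[OF g, symmetric])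
  also have "\<dots> = stabilizer ((g *v light v) $ 1 *\<^sub>R light (ray_image v g))"
    using light_ray_image(3)[OF g v] by (rule arg_cong)
  also have "\<dots> = stabilizer (light (ray_image v g))"
    by (rule stabilizer_scaleR[OF light_ray_image(1)[OF g v]])
  finally show "\<exists>x. norm x = 1 \<and> P = stabilizer (light x)"
    using light_ray_image(2)[OF g v] by blast
next
  assume "\<exists>x. norm x = 1 \<and> P = stabilizer (light x)"
  then obtain x where x: "norm x = 1" and P: "P = stabilizer (light x)"
    by blast
  let ?a = "boost_line x" and ?H = "1 *\<^sub>R boost x"
  have "regular_element so14 ?a ?H"
    unfolding regular_element_def
  proof
    show "?H \<in> ?a" by blast
    show "\<forall>\<alpha>\<in>restricted_roots so14 ?a. \<alpha> ?H \<noteq> 0"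
    proof
      fix \<alpha> assume "\<alpha> \<in> restricted_roots so14 ?a"
      then obtain f H where f: "linear f" "\<alpha> = restrict f ?a" and "H \<in> ?a" "\<alpha> H \<noteq> 0"
        unfolding restricted_roots_def by blast
      then obtain t where "\<alpha> (t *\<^sub>R boost x) \<noteq> 0"
        by blast
      moreover have "\<alpha> (t *\<^sub>R boost x) = t * \<alpha> ?H" for t
        using linear_cmul[OF f(1)] \<open>?H \<in> ?a\<close> by (simp add: f(2))
      ultimately show "\<alpha> ?H \<noteq> 0"
        by auto
    qed
  qed
  moreover have "{} \<subset> simple_roots so14 ?a ?H"
    using simple_roots_boost_line[OF x, of 1] by auto
  moreover have "P = conjugate (mat 1) (parabolic_subgroup SO14 so14 ?a ?H {})"
  proof -
    have "matrix_inv (mat 1 :: real^5^5) = mat 1"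
      by (rule matrix_inv_unique) simp
    then show ?thesis
      using minimal_parabolic_subgroup[OF x, of 1] by (simp add: conjugate_def P)
  qed
  ultimately show "is_proper_parabolic SO14 so14 P"
    unfolding is_proper_parabolic_def
    using maximal_abelian_boost_line[OF x] mat_1_SO14 by blast
qed

lemma stabilizers_conjugate:
  assumes "norm x = 1" "norm y = 1"
  shows "\<exists>g\<in>SO14. stabilizer (light y) = conjugate g (stabilizer (light x))"
proof -
  let ?g = "qrotation y ** matrix_inv (qrotation x)"
  have x: "qrotation x \<in> SO14" and y: "qrotation y \<in> SO14"
    using assms qrotation_SO14 by auto
  have "matrix_inv (qrotation x) *v light x = light (axis 1 1)"
    using SO14_cancel(1)[OF x, of "light (axis 1 1)"] by (simp add: qrotation_light)
  then have "?g *v light x = light y"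
    by (simp add: matrix_vector_mul_assoc[symmetric] qrotation_light)
  moreover have "?g \<in> SO14"
    using x y by (simp add: SO14_mult SO14_inverse)
  ultimately show ?thesis
    using stabilizer_image by metis
qed

theorem proposition4p3:
  shows "(\<exists>P. is_proper_parabolic SO14 so14 P) \<and>
    (\<forall>P Q. is_proper_parabolic SO14 so14 P \<and> is_proper_parabolic SO14 so14 Q \<longrightarrow>
        (\<exists>g\<in>SO14. Q = conjugate g P)) \<and>
    (\<forall>P. is_proper_parabolic SO14 so14 P \<longrightarrow>
        (\<exists>A :: ((real^5^5) set set \<times> ((real^5^5) set \<Rightarrow> real^3)) set.
            quotient_manifold_atlas SO14 P A) \<and>
        (\<forall>A :: ((real^5^5) set set \<times> ((real^5^5) set \<Rightarrow> real^3)) set.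
            quotient_manifold_atlas SO14 P A \<longrightarrow>
            diffeomorphic_to_submanifold (coset_topology SO14 P) A (sphere (0 :: real^4) 1)))"
proof (intro conjI allI impI; (elim conjE)?)
  show "\<exists>P. is_proper_parabolic SO14 so14 P"
    unfolding proper_parabolic_iff by (metis norm_axis_1)
next
  fix P Q assume "is_proper_parabolic SO14 so14 P" "is_proper_parabolic SO14 so14 Q"
  then show "\<exists>g\<in>SO14. Q = conjugate g P"
    using stabilizers_conjugate by (auto simp: proper_parabolic_iff)
next
  fix P assume "is_proper_parabolic SO14 so14 P"
  then obtain x where x: "norm x = 1" and P: "P = stabilizer (light x)"
    by (auto simp: proper_parabolic_iff)
  interpret fibration_over_sphere SO14 P "ray_image x" "{g. (g *v light x) $ 1 \<noteq> 0}"
    unfolding P by (rule fibration_ray_image[OF x])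
  show "\<exists>A :: ((real^5^5) set set \<times> ((real^5^5) set \<Rightarrow> real^3)) set. quotient_manifold_atlas SO14 P A"
    using quotient_atlas_stereo by blast
  fix A :: "((real^5^5) set set \<times> ((real^5^5) set \<Rightarrow> real^3)) set"
  assume "quotient_manifold_atlas SO14 P A"
  then show "diffeomorphic_to_submanifold (coset_topology SO14 P) A (sphere (0 :: real^4) 1)"
    by (rule quotient_diffeomorphic_sphere)
qed

end
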